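(* Under the standing assumptions of the context, the space $C^\infty(\overline{\mathcal{Q}})$ is dense in the Hilbert space $$H=\{u\in L^2(\mathcal{Q}):\ \partial_{x_i}u\in L^2(\mathcal{Q}),\ 1\le i\le d\},\qquad (u,v)_H=(u,v)_{L^2(\mathcal{Q})}+(\nabla_x u,\nabla_x v)_{L^2(\mathcal{Q})},$$ where $\partial_{x_i}u$ are weak derivatives with respect to the spatial variables.
   Context: Standing assumptions: $d\in\{2,3\}$, $\phi\in C^\infty(\mathbb{R}^d\times[t_0,T])$, $\Omega(t)=\{x:\phi(x,t)<0\}$, $\Gamma(t)=\{x:\phi(x,t)=0\}$, $\Omega(t)$ bounded for all $t$, space–time domain $\mathcal{Q}=\bigcup_{t\in(t_0,T)}\Omega(t)\times\{t\}\subset\mathbb{R}^{d+1}$, $\Gamma_\mathcal{Q}=\bigcup_{t\in(t_0,T)}\Gamma(t)\times\{t\}$. $(0,0)$ is the unique point of $\Gamma_\mathcal{Q}$ (or its closure) with $\nabla_x\phi=0$; it satisfies $\det\nabla_x^2\phi(0,0)\ne0$ and $\partial_t\phi(0,0)\ne0$. For $t\neq0$, $\Omega(t)$ has smooth boundary and the evolution is smooth on $(t_0,0)$ and $(0,T)$. Time interval $t_0=-1,T=1$, except if all eigenvalues of $\nabla_x^2\phi(0,0)$ are positive: then $[t_0,T]=[0,1]$ if $\partial_t\phi(0,0)<0$ and $[t_0,T]=[-1,0]$ if $\partial_t\phi(0,0)>0$. *)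

theory Defs
  imports "HOL-Analysis.Analysis"
begin

coinductive smooth_fun :: "('a::euclidean_space \<Rightarrow> real) \<Rightarrow> bool" where
  "(\<forall>x. f differentiable (at x)) \<Longrightarrow>
   (\<forall>b\<in>Basis. smooth_fun (\<lambda>x. frechet_derivative f (at x) b)) \<Longrightarrow> smooth_fun f"

definition dir_deriv :: "('a::euclidean_space \<Rightarrow> real) \<Rightarrow> 'a \<Rightarrow> 'a \<Rightarrow> real" where
  "dir_deriv f v p = frechet_derivative f (at p) v"

definition xdir :: "'n::finite \<Rightarrow> (real^'n) \<times> real" where
  "xdir i = (axis i 1, 0)"

definition hess_x :: "((real^'n::finite) \<times> real \<Rightarrow> real) \<Rightarrow> (real^'n) \<times> real \<Rightarrow> real^'n^'n" where
  "hess_x \<phi> p = (\<chi> i j. dir_deriv (\<lambda>q. dir_deriv \<phi> (xdir j) q) (xdir i) p)"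

definition all_eig_pos :: "real^'n::finite^'n \<Rightarrow> bool" where
  "all_eig_pos A \<longleftrightarrow> (\<forall>c v. v \<noteq> 0 \<and> A *v v = c *\<^sub>R v \<longrightarrow> c > 0)"

definition Qdom :: "((real^'n::finite) \<times> real \<Rightarrow> real) \<Rightarrow> real \<Rightarrow> real \<Rightarrow> ((real^'n) \<times> real) set" where
  "Qdom \<phi> t0 T = {(x, t). t0 < t \<and> t < T \<and> \<phi> (x, t) < 0}"

definition GammaQ :: "((real^'n::finite) \<times> real \<Rightarrow> real) \<Rightarrow> real \<Rightarrow> real \<Rightarrow> ((real^'n) \<times> real) set" where
  "GammaQ \<phi> t0 T = {(x, t). t0 < t \<and> t < T \<and> \<phi> (x, t) = 0}"

definition test_fun :: "'a::euclidean_space set \<Rightarrow> ('a \<Rightarrow> real) \<Rightarrow> bool" where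
  "test_fun Q \<psi> \<longleftrightarrow> smooth_fun \<psi> \<and> compact (closure {p. \<psi> p \<noteq> 0})
      \<and> closure {p. \<psi> p \<noteq> 0} \<subseteq> Q"

definition L2_on :: "'a::euclidean_space set \<Rightarrow> ('a \<Rightarrow> real) \<Rightarrow> bool" where
  "L2_on Q u \<longleftrightarrow> u \<in> borel_measurable (lebesgue_on Q) \<and> integrable (lebesgue_on Q) (\<lambda>p. (u p)^2)"

definition weak_deriv_on :: "'a::euclidean_space set \<Rightarrow> 'a \<Rightarrow> ('a \<Rightarrow> real) \<Rightarrow> ('a \<Rightarrow> real) \<Rightarrow> bool" where
  "weak_deriv_on Q v u g \<longleftrightarrow> (\<forall>\<psi>. test_fun Q \<psi> \<longrightarrow>
      integrable (lebesgue_on Q) (\<lambda>p. u p * dir_deriv \<psi> v p) \<and>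
      integrable (lebesgue_on Q) (\<lambda>p. g p * \<psi> p) \<and>
      integral\<^sup>L (lebesgue_on Q) (\<lambda>p. u p * dir_deriv \<psi> v p)
        = - integral\<^sup>L (lebesgue_on Q) (\<lambda>p. g p * \<psi> p))"

text \<open>H-distance between u (with weak spatial gradient g) and a smooth v.\<close>
definition H_dist :: "((real^'n::finite) \<times> real) set \<Rightarrow> ((real^'n) \<times> real \<Rightarrow> real)
    \<Rightarrow> ('n \<Rightarrow> (real^'n) \<times> real \<Rightarrow> real) \<Rightarrow> ((real^'n) \<times> real \<Rightarrow> real) \<Rightarrow> real" where
  "H_dist Q u g v = sqrt (integral\<^sup>L (lebesgue_on Q) (\<lambda>p. (u p - v p)^2)
      + (\<Sum>i\<in>UNIV. integral\<^sup>L (lebesgue_on Q) (\<lambda>p. (g i p - dir_deriv v (xdir i) p)^2)))"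

end

theory Submission
  imports Defs
begin

text \<open>The space-time domain satisfies the segment condition: near every point there are arbitrarily
  small translations that move the closure of the domain into its interior. At a lateral boundary
  point with nonzero spatial gradient one follows a direction that decreases \<open>\<phi>\<close>, tilted in time
  so as to leave the slices \<open>t = t0\<close> and \<open>t = T\<close>. At the critical point the time derivative is
  nonzero, so the domain is locally a graph over space and one translates in time; when the critical
  point sits on the initial or final slice, the sign of the time derivative makes this direction point
  into the time interval. Spatial weak derivatives commute with all translations, including those in
  time, so a cut-off function, a finite partition and mollification of the translated pieces give
  smooth approximations as in the classical case. Since the union of the time slices need not be
  bounded, one first cuts off at infinity.\<close>

subsection \<open>Smooth functions\<close>

text \<open>The obstacle is the boundary: differentiating a mollification at \<open>x\<close> means
  testing the weak derivative with a kernel placed near \<open>x\<close>, which is admissible only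
  if its support stays in the domain. No extension of \<open>u\<close> across the boundary is
  constructed. Translation and mollification are merged into a single convolution with a kernel
  supported in a small ball about the shift \<open>h\<close>, and \<open>segment_at\<close> asks for
  exactly the room that this kernel needs. The approximant is then smooth on the whole space, and
  only its distance to \<open>u\<close> on the domain has to be estimated. That distance is
  controlled by the continuity of translations in square mean, which holds in every direction,
  whether or not a weak derivative exists there. Errors are kept as squared norms in the extended
  nonnegative reals. The triangle inequality is replaced by (a + b)^2 \<le> 2 a^2 + 2 b^2, which is
  the source of the fractions of \<open>e\<close> throughout.\<close>

text \<open>The class \<open>C\<^sup>k\<close> without the continuity of the top derivatives. Products do not fit the
  coinduction rule of \<open>smooth_fun\<close>, whereas on these finite stages they are handled by induction.\<close>
primrec ck :: "nat \<Rightarrow> ('a::euclidean_space \<Rightarrow> real) \<Rightarrow> bool" where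
  "ck 0 = (\<lambda>f. True)"
| "ck (Suc k) = (\<lambda>f. (\<forall>x. f differentiable (at x)) \<and>
     (\<forall>b\<in>Basis. ck k (\<lambda>x. frechet_derivative f (at x) b)))"

lemma smooth_fun_imp_ck: "smooth_fun f \<Longrightarrow> ck k f"
proof (induction k arbitrary: f)
  case (Suc k)
  from Suc.prems show ?case
    by (cases rule: smooth_fun.cases) (simp add: Suc.IH)
qed simp

text \<open>Membership in all stages at once passes to partial derivatives, so it is an invariant
  for the coinduction rule.\<close>

lemma ck_imp_smooth_fun:
  assumes "\<And>k. ck k f" shows "smooth_fun f"
proof -
  have "\<forall>k. ck k f" using assms by blast
  then show ?thesis
  proof (coinduction arbitrary: f)
    case smooth_fun
    have *: "ck (Suc k) f" for k using smooth_fun by blast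
    show ?case
      using * by (auto intro!: exI[of _ f])
  qed
qed

lemma smooth_fun_iff_ck: "smooth_fun f \<longleftrightarrow> (\<forall>k. ck k f)"
  using smooth_fun_imp_ck ck_imp_smooth_fun by blast

text \<open>By uniqueness of the derivative an explicit \<open>D\<close> may replace the chosen
  \<open>frechet_derivative\<close>; most closure properties below enter through this rule.\<close>

lemma ck_SucI:
  assumes "\<And>x. (f has_derivative D x) (at x)" and "\<And>b. b \<in> Basis \<Longrightarrow> ck k (\<lambda>x. D x b)"
  shows "ck (Suc k) f"
proof -
  have "frechet_derivative f (at x) = D x" for x
    using frechet_derivative_at[OF assms(1)] by simp
  then show ?thesis using assms by (auto intro: differentiableI)
qed

lemma ck_SucD:
  assumes "ck (Suc k) f"
  shows "(f has_derivative frechet_derivative f (at x)) (at x)"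
    and "b \<in> Basis \<Longrightarrow> ck k (\<lambda>x. frechet_derivative f (at x) b)"
  using assms by (auto simp: frechet_derivative_works[symmetric])

lemma ck_mono: "ck (Suc k) f \<Longrightarrow> ck k f"
proof (induction k arbitrary: f)
  case (Suc k)
  show ?case
    using Suc.IH ck_SucD[OF Suc.prems] by (intro ck_SucI) auto
qed simp

lemma ck_const: "ck k (\<lambda>x. c)"
proof (induction k arbitrary: c)
  case (Suc k)
  show ?case by (rule ck_SucI[where D = "\<lambda>x h. 0"]) (use Suc in auto)
qed simp

lemma ck_inner: "ck k (\<lambda>x. x \<bullet> a)"
proof (cases k)
  case (Suc j)
  show ?thesis unfolding Suc
    by (rule ck_SucI[where D = "\<lambda>x h. h \<bullet> a"]) (auto intro!: derivative_eq_intros ck_const)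
qed simp

lemma ck_add: "ck k f \<Longrightarrow> ck k g \<Longrightarrow> ck k (\<lambda>x. f x + g x)"
proof (induction k arbitrary: f g)
  case (Suc k)
  note f = ck_SucD[OF Suc.prems(1)] and g = ck_SucD[OF Suc.prems(2)]
  show ?case
    by (rule ck_SucI[OF has_derivative_add[OF f(1) g(1)]]) (intro Suc.IH f(2) g(2))
qed simp

lemma ck_mult: "ck k f \<Longrightarrow> ck k g \<Longrightarrow> ck k (\<lambda>x. f x * g x)"
proof (induction k arbitrary: f g)
  case (Suc k)
  note f = ck_SucD[OF Suc.prems(1)] and g = ck_SucD[OF Suc.prems(2)]
  \<comment> \<open>The product rule leaves one factor undifferentiated, and \<open>ck_mono\<close>
    lowers that factor to the stage of the induction hypothesis.\<close>
  show ?case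
    by (rule ck_SucI[OF has_derivative_mult[OF f(1) g(1)]])
      (intro ck_add Suc.IH f(2) g(2) ck_mono[OF Suc.prems(1)] ck_mono[OF Suc.prems(2)])
qed simp

lemma ck_sum: "(\<And>i. i \<in> I \<Longrightarrow> ck k (f i)) \<Longrightarrow> ck k (\<lambda>x. \<Sum>i\<in>I. f i x)"
  by (induction I rule: infinite_finite_induct) (auto intro: ck_add ck_const)

lemma ck_shift: "ck k f \<Longrightarrow> ck k (\<lambda>x. f (x - a))"
proof (induction k arbitrary: f)
  case (Suc k)
  note f = ck_SucD[OF Suc.prems(1)]
  have "((\<lambda>x. f (x - a)) has_derivative (\<lambda>h. frechet_derivative f (at (x - a)) h)) (at x)" for x
    by (rule has_derivative_compose[OF _ f(1)]) (auto intro!: derivative_eq_intros)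
  then show ?case
    by (rule ck_SucI) (intro Suc.IH f(2))
qed simp

lemma smooth_const: "smooth_fun (\<lambda>x. c)"
  and smooth_add: "smooth_fun f \<Longrightarrow> smooth_fun g \<Longrightarrow> smooth_fun (\<lambda>x. f x + g x)"
  and smooth_mult: "smooth_fun f \<Longrightarrow> smooth_fun g \<Longrightarrow> smooth_fun (\<lambda>x. f x * g x)"
  and smooth_shift: "smooth_fun f \<Longrightarrow> smooth_fun (\<lambda>x. f (x - a))"
  by (simp_all add: smooth_fun_iff_ck ck_const ck_add ck_mult ck_shift)

lemma smooth_diff:
  assumes "smooth_fun f" "smooth_fun g" shows "smooth_fun (\<lambda>x. f x - g x)"
  using smooth_add[OF assms(1) smooth_mult[OF smooth_const[of "-1"] assms(2)]] by simp

lemma smooth_has_derivative: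
  "smooth_fun f \<Longrightarrow> (f has_derivative frechet_derivative f (at x)) (at x)"
  using ck_SucD(1)[of 0 f] smooth_fun_imp_ck[of f "Suc 0"] by blast

lemma smooth_frechet:
  "smooth_fun f \<Longrightarrow> b \<in> Basis \<Longrightarrow> smooth_fun (\<lambda>x. frechet_derivative f (at x) b)"
  using ck_SucD(2) smooth_fun_iff_ck by blast

lemma smooth_dir_deriv:
  "smooth_fun f \<Longrightarrow> b \<in> Basis \<Longrightarrow> smooth_fun (dir_deriv f b)"
  unfolding dir_deriv_def by (rule smooth_frechet)

lemma smooth_continuous_on: "smooth_fun f \<Longrightarrow> continuous_on S f"
  by (meson continuous_at_imp_continuous_on has_derivative_continuous smooth_has_derivative)

lemma dir_deriv_eqI: "(f has_derivative D) (at x) \<Longrightarrow> dir_deriv f b x = D b"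
  unfolding dir_deriv_def using frechet_derivative_at by metis

lemma dir_deriv_add:
  "smooth_fun f \<Longrightarrow> smooth_fun g \<Longrightarrow>
    dir_deriv (\<lambda>x. f x + g x) b x = dir_deriv f b x + dir_deriv g b x"
  by (rule dir_deriv_eqI[THEN trans, OF has_derivative_add[OF smooth_has_derivative smooth_has_derivative]])
    (auto simp: dir_deriv_def)

lemma dir_deriv_mult:
  "smooth_fun f \<Longrightarrow> smooth_fun g \<Longrightarrow>
    dir_deriv (\<lambda>x. f x * g x) b x = f x * dir_deriv g b x + dir_deriv f b x * g x"
  by (rule dir_deriv_eqI[THEN trans, OF has_derivative_mult[OF smooth_has_derivative smooth_has_derivative]])
    (auto simp: dir_deriv_def)

lemma dir_deriv_shift:
  assumes "smooth_fun f"
  shows "dir_deriv (\<lambda>x. f (x - a)) b x = dir_deriv f b (x - a)"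
proof -
  have "((\<lambda>x. f (x - a)) has_derivative (\<lambda>h. frechet_derivative f (at (x - a)) h)) (at x)"
    by (rule has_derivative_compose[OF _ smooth_has_derivative[OF assms]])
      (auto intro!: derivative_eq_intros)
  from dir_deriv_eqI[OF this] show ?thesis by (simp add: dir_deriv_def)
qed

lemma dir_deriv_const: "dir_deriv (\<lambda>x. c) b x = 0"
  by (rule dir_deriv_eqI[where D = "\<lambda>h. 0"]) simp

lemma dir_deriv_eq_0:
  fixes f :: "'a::euclidean_space \<Rightarrow> real"
  assumes "open U" "x \<in> U" "\<And>y. y \<in> U \<Longrightarrow> f y = c"
  shows "dir_deriv f b x = 0"
proof (rule dir_deriv_eqI[where D = "\<lambda>h. 0"])
  show "(f has_derivative (\<lambda>h. 0)) (at x)"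
    by (rule has_derivative_transform_within_open[OF has_derivative_const[of c] assms(1,2)])
      (use assms(3) in auto)
qed

lemma frechet_derivative_eq_sum:
  assumes "smooth_fun f"
  shows "frechet_derivative f (at x) h = (\<Sum>b\<in>Basis. (h \<bullet> b) * dir_deriv f b x)"
proof -
  have lin: "linear (frechet_derivative f (at x))"
    by (rule has_derivative_linear[OF smooth_has_derivative[OF assms]])
  have "frechet_derivative f (at x) h = frechet_derivative f (at x) (\<Sum>b\<in>Basis. (h \<bullet> b) *\<^sub>R b)"
    by (simp add: euclidean_representation)
  also have "\<dots> = (\<Sum>b\<in>Basis. (h \<bullet> b) * dir_deriv f b x)"
    by (simp add: linear_sum[OF lin] linear_cmul[OF lin] dir_deriv_def)
  finally show ?thesis .
qed

subsection \<open>Bump functions\<close>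

text \<open>A family containing \<open>exp (- 1 / t)\<close> that is closed under differentiation.\<close>
definition flat :: "real poly \<Rightarrow> real \<Rightarrow> real" where
  "flat P t = (if t > 0 then poly P (1 / t) * exp (- (1 / t)) else 0)"

lemma poly_div_exp_0: "((\<lambda>s. poly P s / exp s) \<longlongrightarrow> (0::real)) at_top"
proof -
  have "((\<lambda>s. \<Sum>i\<le>degree P. coeff P i * (s ^ i / exp s)) \<longlongrightarrow> (\<Sum>i\<le>degree P. coeff P i * 0)) at_top"
    by (intro tendsto_intros tendsto_power_div_exp_0)
  then show ?thesis by (simp add: poly_altdef sum_divide_distrib)
qed

lemma flat_tendsto_0: "(flat P \<longlongrightarrow> 0) (at 0)"
proof -
  have "((\<lambda>t. poly P (inverse t) / exp (inverse t)) \<longlongrightarrow> (0::real)) (at_right 0)"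
    using filterlim_compose[OF poly_div_exp_0[of P] filterlim_inverse_at_top_right] by simp
  then have "(flat P \<longlongrightarrow> 0) (at_right 0)"
    by (rule Lim_transform_eventually)
      (auto simp: eventually_at_filter flat_def exp_minus field_simps)
  moreover have "(flat P \<longlongrightarrow> 0) (at_left 0)"
    by (rule Lim_transform_eventually[OF tendsto_const])
      (auto simp: eventually_at_filter flat_def)
  ultimately show ?thesis by (simp add: filterlim_at_split)
qed

text \<open>With s = 1 / t, the derivative of P(s) exp(-s) in t is s^2 (P(s) - P'(s)) exp(-s), and
  \<open>[:0, 0, 1:]\<close> is the polynomial s^2.\<close>

lemma flat_has_derivative:
  "(flat P has_real_derivative flat ([:0, 0, 1:] * (P - pderiv P)) t) (at t)"
proof -
  consider "t > 0" | "t < 0" | "t = 0" by linarith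
  then show ?thesis
  proof cases
    case 1
    have "((\<lambda>t. poly P (1 / t) * exp (- (1 / t))) has_real_derivative
        flat ([:0, 0, 1:] * (P - pderiv P)) t) (at t)"
      using 1 by (auto intro!: derivative_eq_intros DERIV_chain'[OF _ poly_DERIV]
          simp: flat_def field_simps power2_eq_square)
    then show ?thesis
      by (rule has_field_derivative_transform_within_open[where S = "{0<..}"])
        (use 1 in \<open>auto simp: flat_def\<close>)
  next
    case 2
    then have "flat ([:0, 0, 1:] * (P - pderiv P)) t = 0" by (simp add: flat_def)
    then show ?thesis
      by (simp, intro has_field_derivative_transform_within_open[OF DERIV_const, where S = "{..<0}"])
        (use 2 in \<open>auto simp: flat_def\<close>)
  next
    case 3
    \<comment> \<open>Division by \<open>h\<close> multiplies the polynomial in 1 / h by one more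
      power, so the difference quotient at 0 is again a member of the family.\<close>
    have "((\<lambda>h. flat ([:0, 1:] * P) h) \<longlongrightarrow> 0) (at 0)"
      by (rule flat_tendsto_0)
    then have "((\<lambda>h. (flat P (0 + h) - flat P 0) / h) \<longlongrightarrow> 0) (at 0)"
      by (rule Lim_transform_eventually) (auto simp: eventually_at_filter flat_def)
    then show ?thesis using 3 by (simp add: DERIV_def flat_def)
  qed
qed

text \<open>Each differentiation changes the polynomial, hence the induction is over all
  \<open>P\<close> at once.\<close>

lemma ck_flat:
  assumes q: "\<And>k. ck k q"
  shows "ck k (\<lambda>x. flat P (q x))"
proof (induction k arbitrary: P)
  case (Suc k)
  have "((\<lambda>x. flat P (q x)) has_derivative
      (\<lambda>h. flat ([:0, 0, 1:] * (P - pderiv P)) (q x) * frechet_derivative q (at x) h)) (at x)" for x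
    using has_derivative_compose[OF ck_SucD(1)[OF q, of x]
        flat_has_derivative[unfolded has_field_derivative_def]] by (simp add: o_def mult.commute)
  then show ?case
    by (rule ck_SucI) (intro ck_mult Suc.IH ck_SucD(2)[OF q])
qed simp

lemma ex_bump:
  fixes h :: "'a::euclidean_space"
  assumes "d > 0"
  shows "\<exists>k. smooth_fun k \<and> (\<forall>z. k z \<ge> 0) \<and> (\<forall>z. z \<notin> ball h d \<longrightarrow> k z = 0) \<and> (\<forall>z\<in>ball h d. k z > 0)"
proof -
  \<comment> \<open>The standard bump exp(-1 / (d^2 - |z - h|^2)). The squared distance is spelled
    out in coordinates so that the closure rules for \<open>ck\<close> reach it.\<close>
  define k where "k = (\<lambda>z. flat 1 (d\<^sup>2 - (\<Sum>b\<in>Basis. ((z - h) \<bullet> b) * ((z - h) \<bullet> b))))"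
  have eq: "k z = flat 1 (d\<^sup>2 - (dist h z)\<^sup>2)" for z
  proof -
    have "(\<Sum>b\<in>Basis. ((z - h) \<bullet> b) * ((z - h) \<bullet> b)) = (dist z h)\<^sup>2"
      by (simp add: dist_norm power2_norm_eq_inner euclidean_inner[symmetric])
    then show ?thesis by (simp add: k_def dist_commute)
  qed
  have ck: "ck j (\<lambda>z. (z - h) \<bullet> b)" for j b
    using ck_shift[OF ck_inner] by blast
  have "ck j (\<lambda>z. d\<^sup>2 + (-1) * (\<Sum>b\<in>Basis. ((z - h) \<bullet> b) * ((z - h) \<bullet> b)))" for j
    by (intro ck_add ck_mult ck_sum ck_const ck)
  then have "smooth_fun k"
    unfolding k_def smooth_fun_iff_ck by (intro allI ck_flat) simp
  moreover have "d\<^sup>2 - (dist h z)\<^sup>2 > 0 \<longleftrightarrow> z \<in> ball h d" for z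
    using assms by (auto intro: power2_less_imp_less power_strict_mono)
  ultimately show ?thesis
    by (intro exI[of _ k]) (auto simp: eq flat_def)
qed

subsection \<open>Mollification in square mean\<close>

text \<open>The squared L2 norm as an extended nonnegative number, so that finiteness is a plain
  inequality and the order of integration can be exchanged without integrability conditions.\<close>

definition l2sq :: "('a::euclidean_space \<Rightarrow> real) \<Rightarrow> ennreal" where
  "l2sq f = (\<integral>\<^sup>+x. ennreal ((f x)\<^sup>2) \<partial>lborel)"

lemma l2sq_mono: "(\<And>x. \<bar>f x\<bar> \<le> \<bar>g x\<bar>) \<Longrightarrow> l2sq f \<le> l2sq g"
  unfolding l2sq_def by (intro nn_integral_mono ennreal_leI) (simp add: abs_le_square_iff)

lemma l2sq_add:
  assumes [measurable]: "f \<in> borel_measurable borel" "g \<in> borel_measurable borel"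
  shows "l2sq (\<lambda>x. f x + g x) \<le> 2 * l2sq f + 2 * l2sq g"
proof -
  have "(f x + g x)\<^sup>2 \<le> 2 * (f x)\<^sup>2 + 2 * (g x)\<^sup>2" for x
    using sum_squares_bound[of "f x" "g x"] by (simp add: power2_sum)
  then have "ennreal ((f x + g x)\<^sup>2) \<le> ennreal (2 * (f x)\<^sup>2 + 2 * (g x)\<^sup>2)" for x
    by (rule ennreal_leI)
  then have "ennreal ((f x + g x)\<^sup>2) \<le> 2 * ennreal ((f x)\<^sup>2) + 2 * ennreal ((g x)\<^sup>2)" for x
    by (simp add: ennreal_mult')
  then have "l2sq (\<lambda>x. f x + g x)
      \<le> (\<integral>\<^sup>+x. 2 * ennreal ((f x)\<^sup>2) + 2 * ennreal ((g x)\<^sup>2) \<partial>lborel)"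
    unfolding l2sq_def by (intro nn_integral_mono)
  also have "\<dots> = 2 * l2sq f + 2 * l2sq g"
    unfolding l2sq_def by (simp add: nn_integral_add nn_integral_cmult)
  finally show ?thesis .
qed

lemma l2sq_add_le:
  assumes "f \<in> borel_measurable borel" "g \<in> borel_measurable borel"
    and "l2sq f \<le> ennreal a" "l2sq g \<le> ennreal b" "a \<ge> 0" "b \<ge> 0"
  shows "l2sq (\<lambda>x. f x + g x) \<le> ennreal (2 * a + 2 * b)"
proof -
  have "l2sq (\<lambda>x. f x + g x) \<le> 2 * ennreal a + 2 * ennreal b"
    by (rule order_trans[OF l2sq_add[OF assms(1,2)]]) (intro add_mono mult_left_mono assms; simp)
  also have "\<dots> = ennreal (2 * a + 2 * b)"
    using assms by (simp add: ennreal_mult')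
  finally show ?thesis .
qed

lemma l2sq_minus: "l2sq (\<lambda>x. - f x) = l2sq f"
  by (simp add: l2sq_def)

lemma l2sq_diff_le:
  assumes "f \<in> borel_measurable borel" "g \<in> borel_measurable borel"
    and "l2sq f \<le> ennreal a" "l2sq g \<le> ennreal b" "a \<ge> 0" "b \<ge> 0"
  shows "l2sq (\<lambda>x. f x - g x) \<le> ennreal (2 * a + 2 * b)"
  using l2sq_add_le[of f "\<lambda>x. - g x" a b] assms by (simp add: l2sq_minus)

lemma l2sq_cmult:
  assumes [measurable]: "f \<in> borel_measurable borel"
  shows "l2sq (\<lambda>x. c * f x) = ennreal (c\<^sup>2) * l2sq f"
  unfolding l2sq_def by (subst nn_integral_cmult[symmetric]) (auto simp: power_mult_distrib ennreal_mult)

lemma nn_integral_lborel_shift: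
  fixes h :: "'a::euclidean_space"
  assumes [measurable]: "f \<in> borel_measurable borel"
  shows "(\<integral>\<^sup>+x. f (x + h) \<partial>lborel) = (\<integral>\<^sup>+x. f x \<partial>lborel)"
proof -
  have "(\<integral>\<^sup>+x. f x \<partial>lborel) = (\<integral>\<^sup>+x. f x \<partial>distr lborel borel ((+) h))"
    by (simp add: lborel_distr_plus)
  also have "\<dots> = (\<integral>\<^sup>+x. f (h + x) \<partial>lborel)"
    by (rule nn_integral_distr) auto
  finally show ?thesis by (simp add: add.commute)
qed

lemma integral_lborel_shift:
  fixes f :: "'a::euclidean_space \<Rightarrow> real"
  assumes [measurable]: "f \<in> borel_measurable borel"
  shows "(\<integral>x. f (x + h) \<partial>lborel) = (\<integral>x. f x \<partial>lborel)"
proof -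
  have "(\<integral>x. f x \<partial>lborel) = (\<integral>x. f x \<partial>distr lborel borel ((+) h))"
    by (simp add: lborel_distr_plus)
  also have "\<dots> = (\<integral>x. f (h + x) \<partial>lborel)"
    by (rule integral_distr) auto
  finally show ?thesis by (simp add: add.commute)
qed

lemma integrable_lborel_shift:
  fixes f :: "'a::euclidean_space \<Rightarrow> real"
  assumes "integrable lborel f"
  shows "integrable lborel (\<lambda>x. f (x + h))"
proof -
  have [measurable]: "f \<in> borel_measurable borel"
    using borel_measurable_integrable[OF assms] by simp
  have "integrable (distr lborel borel ((+) h)) f"
    using assms by (simp add: lborel_distr_plus)
  then have "integrable lborel (\<lambda>x. f (h + x))"
    by (subst (asm) integrable_distr_eq) auto
  then show ?thesis by (simp add: add.commute)
qed

lemma l2sq_shift: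
  assumes [measurable]: "f \<in> borel_measurable borel"
  shows "l2sq (\<lambda>x. f (x + h)) = l2sq f"
  unfolding l2sq_def by (rule nn_integral_lborel_shift[of "\<lambda>x. ennreal ((f x)\<^sup>2)"]) simp

section \<open>Continuity of translations in square mean\<close>

definition trans_cont :: "('a::euclidean_space \<Rightarrow> real) \<Rightarrow> bool" where
  "trans_cont f \<longleftrightarrow> (\<forall>e>0. \<exists>d>0. \<forall>h. norm h < d \<longrightarrow> l2sq (\<lambda>x. f (x + h) - f x) \<le> ennreal e)"

lemma trans_cont_add:
  assumes [measurable]: "f \<in> borel_measurable borel" "g \<in> borel_measurable borel"
    and f: "trans_cont f" and g: "trans_cont g"
  shows "trans_cont (\<lambda>x. f x + g x)"
  unfolding trans_cont_def
proof (intro allI impI)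
  fix e :: real assume "e > 0"
  then have "e / 4 > 0" by simp
  with f obtain d1 where d1: "d1 > 0"
      "\<And>h. norm h < d1 \<Longrightarrow> l2sq (\<lambda>x. f (x + h) - f x) \<le> ennreal (e/4)"
    unfolding trans_cont_def by blast
  from g \<open>e / 4 > 0\<close> obtain d2 where d2: "d2 > 0"
      "\<And>h. norm h < d2 \<Longrightarrow> l2sq (\<lambda>x. g (x + h) - g x) \<le> ennreal (e/4)"
    unfolding trans_cont_def by blast
  show "\<exists>d>0. \<forall>h. norm h < d \<longrightarrow> l2sq (\<lambda>x. f (x + h) + g (x + h) - (f x + g x)) \<le> ennreal e"
  proof (intro exI[of _ "min d1 d2"] conjI allI impI)
    fix h :: 'a assume "norm h < min d1 d2"
    then have "l2sq (\<lambda>x. (f (x + h) - f x) + (g (x + h) - g x)) \<le> ennreal (2 * (e/4) + 2 * (e/4))"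
      using \<open>e > 0\<close> by (intro l2sq_add_le d1 d2) auto
    then show "l2sq (\<lambda>x. f (x + h) + g (x + h) - (f x + g x)) \<le> ennreal e"
      by (simp add: algebra_simps)
  qed (use d1 d2 in auto)
qed

lemma trans_cont_cmult:
  assumes [measurable]: "f \<in> borel_measurable borel" and f: "trans_cont f"
  shows "trans_cont (\<lambda>x. c * f x)"
  unfolding trans_cont_def
proof (intro allI impI)
  fix e :: real assume "e > 0"
  \<comment> \<open>The summand 1 keeps the quotient below meaningful when \<open>c\<close> is
    0.\<close>
  have c: "c\<^sup>2 + 1 > 0" by (simp add: add_nonneg_pos)
  then have "e / (c\<^sup>2 + 1) > 0" using \<open>e > 0\<close> by simp
  then obtain d where d: "d > 0"
      "\<And>h. norm h < d \<Longrightarrow> l2sq (\<lambda>x. f (x + h) - f x) \<le> ennreal (e / (c\<^sup>2 + 1))"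
    using f unfolding trans_cont_def by blast
  show "\<exists>d>0. \<forall>h. norm h < d \<longrightarrow> l2sq (\<lambda>x. c * f (x + h) - c * f x) \<le> ennreal e"
  proof (intro exI[of _ d] conjI allI impI)
    fix h :: 'a assume "norm h < d"
    have "l2sq (\<lambda>x. c * f (x + h) - c * f x) = ennreal (c\<^sup>2) * l2sq (\<lambda>x. f (x + h) - f x)"
      by (subst l2sq_cmult[symmetric]) (auto simp: algebra_simps)
    also have "\<dots> \<le> ennreal (c\<^sup>2) * ennreal (e / (c\<^sup>2 + 1))"
      by (intro mult_left_mono d \<open>norm h < d\<close>) simp
    also have "\<dots> = ennreal (c\<^sup>2 * (e / (c\<^sup>2 + 1)))"
      by (rule ennreal_mult'[symmetric]) simp
    also have "\<dots> \<le> ennreal e"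
      using \<open>e > 0\<close> c by (intro ennreal_leI) (simp add: field_simps)
    finally show "l2sq (\<lambda>x. c * f (x + h) - c * f x) \<le> ennreal e" .
  qed (use d in auto)
qed

lemma trans_cont_limit:
  assumes [measurable]: "f \<in> borel_measurable borel"
    and lim: "\<And>e. e > 0 \<Longrightarrow> \<exists>g. g \<in> borel_measurable borel \<and> trans_cont g \<and> l2sq (\<lambda>x. f x - g x) \<le> ennreal e"
  shows "trans_cont f"
  unfolding trans_cont_def
proof (intro allI impI)
  fix e :: real assume "e > 0"
  \<comment> \<open>The difference is split as (f - g)(x + h) - (f - g)(x) + (g(x + h) - g(x)); with
    each part at most e / 10, the two applications of the quadratic inequality give 2 (4 e / 10) + 2
    e / 10 = e.\<close>
  then have e: "e / 10 > 0" by simp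
  obtain g where [measurable]: "g \<in> borel_measurable borel"
    and g: "trans_cont g" "l2sq (\<lambda>x. f x - g x) \<le> ennreal (e/10)"
    using lim[OF e] by blast
  obtain d where d: "d > 0" "\<And>h. norm h < d \<Longrightarrow> l2sq (\<lambda>x. g (x + h) - g x) \<le> ennreal (e/10)"
    using g(1) e unfolding trans_cont_def by blast
  show "\<exists>d>0. \<forall>h. norm h < d \<longrightarrow> l2sq (\<lambda>x. f (x + h) - f x) \<le> ennreal e"
  proof (intro exI[of _ d] conjI allI impI)
    fix h :: 'a assume h: "norm h < d"
    have "l2sq (\<lambda>x. f (x + h) - g (x + h)) \<le> ennreal (e/10)"
      using g(2) l2sq_shift[of "\<lambda>x. f x - g x" h] by simp
    then have "l2sq (\<lambda>x. (f (x + h) - g (x + h)) - (f x - g x)) \<le> ennreal (2 * (e/10) + 2 * (e/10))"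
      using \<open>e > 0\<close> g by (intro l2sq_diff_le) auto
    then have "l2sq (\<lambda>x. ((f (x + h) - g (x + h)) - (f x - g x)) + (g (x + h) - g x))
        \<le> ennreal (2 * (2 * (e/10) + 2 * (e/10)) + 2 * (e/10))"
      using \<open>e > 0\<close> by (intro l2sq_add_le d h) auto
    then show "l2sq (\<lambda>x. f (x + h) - f x) \<le> ennreal e"
      by (simp add: algebra_simps)
  qed (use d in auto)
qed

text \<open>Regularity of Lebesgue measure supplies an open superset and a closed subset. Finite
  measure gives continuity from above, so a large ball cuts the closed set down to a compact one at
  small cost.\<close>

lemma ex_compact_open_approx:
  fixes A :: "'a::euclidean_space set"
  assumes A: "A \<in> sets borel" and fin: "emeasure lborel A < \<infinity>" and e: "e > 0"
  shows "\<exists>K U. compact K \<and> open U \<and> K \<subseteq> A \<and> A \<subseteq> U \<and> emeasure lborel (U - K) \<le> ennreal e"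
proof -
  have "A \<in> sets lebesgue" using A by simp
  have e3: "e / 3 > 0" using e by simp
  obtain U where U: "open U" "A \<subseteq> U" "U - A \<in> lmeasurable" "emeasure lebesgue (U - A) < ennreal (e/3)"
    using sets_lebesgue_outer_open[OF \<open>A \<in> sets lebesgue\<close> e3] by metis
  obtain C where C: "closed C" "C \<subseteq> A" "emeasure lebesgue (A - C) < ennreal (e/3)"
    using sets_lebesgue_inner_closed[OF \<open>A \<in> sets lebesgue\<close> e3] by metis
  have [measurable]: "C \<in> sets borel" "U \<in> sets borel" "A \<in> sets borel"
    using C U A by auto
  have "emeasure lborel C \<le> emeasure lborel A" by (intro emeasure_mono) (use C in auto)
  then have Cfin: "emeasure lborel C < \<infinity>" using fin by order
  have "(\<lambda>n. emeasure lborel (C - cball 0 (real n))) \<longlonglongrightarrow> emeasure lborel (\<Inter>n. C - cball 0 (real n))"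
  proof (rule Lim_emeasure_decseq)
    show "range (\<lambda>n. C - cball 0 (real n)) \<subseteq> sets lborel" by auto
    show "decseq (\<lambda>n. C - cball 0 (real n))" by (auto simp: decseq_def)
    have "emeasure lborel (C - cball 0 (real n)) \<le> emeasure lborel C" for n
      by (intro emeasure_mono) auto
    then show "emeasure lborel (C - cball 0 (real n)) \<noteq> \<infinity>" for n
      using Cfin by (metis infinity_ennreal_def linorder_not_less)
  qed
  moreover have "(\<Inter>n. C - cball 0 (real n)) = {}"
    using real_arch_simple by (fastforce simp: dist_norm)
  ultimately have "(\<lambda>n. emeasure lborel (C - cball 0 (real n))) \<longlonglongrightarrow> 0"
    by (simp only: emeasure_empty)
  then have "\<forall>\<^sub>F n in sequentially. emeasure lborel (C - cball 0 (real n)) < ennreal (e/3)"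
    by (rule order_tendstoD) (use e3 in simp)
  then obtain n where n: "emeasure lborel (C - cball 0 (real n)) < ennreal (e/3)"
    using eventually_happens'[OF sequentially_bot] by blast
  define K where "K = C \<inter> cball 0 (real n)"
  have "emeasure lborel (U - K) \<le> emeasure lborel ((U - A) \<union> ((A - C) \<union> (C - cball 0 (real n))))"
    by (intro emeasure_mono) (auto simp: K_def)
  also have "\<dots> \<le> emeasure lborel (U - A) + (emeasure lborel (A - C) + emeasure lborel (C - cball 0 (real n)))"
    by (intro order_trans[OF emeasure_subadditive] add_left_mono emeasure_subadditive) auto
  also have "\<dots> \<le> ennreal (e/3) + (ennreal (e/3) + ennreal (e/3))"
    using U(4) C(3) n by (intro add_mono) (auto simp: less_imp_le)
  also have "\<dots> = ennreal e"
    using e by (simp flip: ennreal_plus)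
  finally have "emeasure lborel (U - K) \<le> ennreal e" .
  moreover have "compact K" "K \<subseteq> A"
    using C by (auto simp: K_def closed_Int_compact)
  ultimately show ?thesis using U by blast
qed

text \<open>Suppose the indicator differs at \<open>x\<close> and \<open>x + h\<close>. The point
  that lies in \<open>A\<close> lies in \<open>U\<close>; if it even lies in \<open>K\<close>, then
  the other one is in \<open>U\<close> but not in \<open>A\<close>. Either way one of the two points
  lies in the small set \<open>U - K\<close>.\<close>

lemma trans_cont_indicator:
  fixes A :: "'a::euclidean_space set"
  assumes A [measurable]: "A \<in> sets borel" and fin: "emeasure lborel A < \<infinity>"
  shows "trans_cont (indicator A)"
  unfolding trans_cont_def
proof (intro allI impI)
  fix e :: real assume "e > 0"
  then have "e / 2 > 0" by simp
  from ex_compact_open_approx[OF A fin this] obtain K U where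
    K: "compact K" and U: "open U" and KA: "K \<subseteq> A" and AU: "A \<subseteq> U"
    and UK: "emeasure lborel (U - K) \<le> ennreal (e/2)" by blast
  have [measurable]: "U \<in> sets borel" "K \<in> sets borel" using U K by (auto intro: borel_compact)
  obtain d where d: "d > 0" "(\<Union>x\<in>K. ball x d) \<subseteq> U"
    using compact_subset_open_imp_ball_epsilon_subset[OF K U] KA AU by blast
  show "\<exists>d>0. \<forall>h. norm h < d \<longrightarrow> l2sq (\<lambda>x. indicator A (x + h) - indicator A x) \<le> ennreal e"
  proof (intro exI[of _ d] conjI allI impI)
    fix h :: 'a assume h: "norm h < d"
    have KU: "x + h \<in> U" "x - h \<in> U" if "x \<in> K" for x
      using d(2) that h by (force simp: dist_norm)+
    have KU': "x \<in> U" if "x + h \<in> K" for x using KU(2)[OF that] by simp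
    have "ennreal ((indicator A (x + h) - indicator A x)\<^sup>2)
        \<le> indicator (U - K) x + indicator (U - K) (x + h)" for x
      using KA AU KU(1)[of x] KU'[of x] by (auto simp: indicator_def)
    then have "l2sq (\<lambda>x. indicator A (x + h) - indicator A x)
        \<le> (\<integral>\<^sup>+x. indicator (U - K) x + indicator (U - K) (x + h) \<partial>lborel)"
      unfolding l2sq_def by (intro nn_integral_mono)
    also have "\<dots> = emeasure lborel (U - K) + (\<integral>\<^sup>+x. indicator (U - K) (x + h) \<partial>lborel)"
      by (simp add: nn_integral_add)
    also have "(\<integral>\<^sup>+x. indicator (U - K) (x + h) \<partial>lborel) = emeasure lborel (U - K)"
      by (subst nn_integral_lborel_shift) auto
    also have "emeasure lborel (U - K) + emeasure lborel (U - K) \<le> ennreal (e/2) + ennreal (e/2)"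
      by (intro add_mono UK)
    also have "\<dots> = ennreal e"
      using \<open>e > 0\<close> by (simp flip: ennreal_plus)
    finally show "l2sq (\<lambda>x. indicator A (x + h) - indicator A x) \<le> ennreal e" .
  qed (use d in auto)
qed

text \<open>Induction over simple functions and increasing limits. Finiteness stands in the
  conclusion because it has to be handed down to summands and approximants, all of which are
  dominated by the whole. In the limit step the squared difference is dominated by the square of
  \<open>f\<close>.\<close>

lemma trans_cont_L2_nonneg:
  fixes f :: "'a::euclidean_space \<Rightarrow> real"
  assumes "f \<in> borel_measurable borel" "\<And>x. f x \<ge> 0"
  shows "l2sq f < \<infinity> \<longrightarrow> trans_cont f"
  using assms
proof (induction rule: borel_measurable_induct_real)
  case (set A)
  have "l2sq (indicator A) = emeasure lborel A"
  proof -
    have "l2sq (indicator A) = (\<integral>\<^sup>+x. indicator A x \<partial>lborel)"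
      unfolding l2sq_def by (intro nn_integral_cong) (auto simp: indicator_def)
    then show ?thesis using set by simp
  qed
  then show ?case using trans_cont_indicator set by auto
next
  case (mult u c)
  show ?case
  \<comment> \<open>For \<open>c = 0\<close> the product has finite norm even when \<open>u\<close>
    does not, so the induction hypothesis says nothing.\<close>
  proof (cases "c = 0")
    case True
    then show ?thesis by (simp add: trans_cont_def l2sq_def)
  next
    case False
    then show ?thesis
      using mult l2sq_cmult[of u c] trans_cont_cmult[of u c]
      by (auto simp: ennreal_mult_less_top)
  qed
next
  case (add u v)
  have "l2sq u \<le> l2sq (\<lambda>x. v x + u x)" "l2sq v \<le> l2sq (\<lambda>x. v x + u x)"
    by (intro l2sq_mono; use add in simp)+
  then have "l2sq (\<lambda>x. v x + u x) < \<infinity> \<Longrightarrow> trans_cont u \<and> trans_cont v"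
    using add.IH le_less_trans by blast
  then show ?case using trans_cont_add[OF add.hyps(3,1)] by blast
next
  case (seq U)
  note [measurable] = seq.hyps(1)
  have le: "U i x \<le> f x" for i x
    by (rule incseq_le[of "\<lambda>i. U i x"]) (use seq.hyps(3,4) in \<open>auto simp: incseq_def le_fun_def\<close>)
  have [measurable]: "f \<in> borel_measurable borel"
    by (rule borel_measurable_LIMSEQ_real[of _ U]) (use seq.hyps in auto)
  show ?case
  proof
    assume fin: "l2sq f < \<infinity>"
    have U: "trans_cont (U i)" for i
    proof -
      have "l2sq (U i) \<le> l2sq f" 
        using order_trans[OF seq.hyps(2) le] seq.hyps(2) le by (intro l2sq_mono) simp
      then show ?thesis using seq.IH fin le_less_trans by blast
    qed
    have "(\<lambda>i. l2sq (\<lambda>x. f x - U i x)) \<longlonglongrightarrow> (\<integral>\<^sup>+x. 0 \<partial>(lborel::'a measure))"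
      unfolding l2sq_def
    proof (rule nn_integral_dominated_convergence)
      show "AE x in lborel. ennreal ((f x - U i x)\<^sup>2) \<le> ennreal ((f x)\<^sup>2)" for i
        using seq.hyps(2) le by (auto intro!: ennreal_leI power_mono)
      show "AE x in lborel. (\<lambda>i. ennreal ((f x - U i x)\<^sup>2)) \<longlonglongrightarrow> 0"
      proof (rule AE_I2)
        fix x
        have "(\<lambda>i. (f x - U i x)\<^sup>2) \<longlonglongrightarrow> (f x - f x)\<^sup>2"
          by (intro tendsto_intros seq.hyps(4)) auto
        then show "(\<lambda>i. ennreal ((f x - U i x)\<^sup>2)) \<longlonglongrightarrow> 0"
          using tendsto_ennrealI by fastforce
      qed
      show "(\<integral>\<^sup>+ x. ennreal ((f x)\<^sup>2) \<partial>lborel) < \<infinity>" using fin by (simp add: l2sq_def)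
    qed auto
    then have lim: "(\<lambda>i. l2sq (\<lambda>x. f x - U i x)) \<longlonglongrightarrow> 0" by simp
    show "trans_cont f"
    proof (rule trans_cont_limit)
      fix e :: real assume "e > 0"
      then have "\<forall>\<^sub>F i in sequentially. l2sq (\<lambda>x. f x - U i x) < ennreal e"
        by (intro order_tendstoD(2)[OF lim]) simp
      then obtain i where "l2sq (\<lambda>x. f x - U i x) < ennreal e"
        using eventually_happens'[OF sequentially_bot] by blast
      then show "\<exists>g. g \<in> borel_measurable borel \<and> trans_cont g \<and> l2sq (\<lambda>x. f x - g x) \<le> ennreal e"
        using U by (intro exI[of _ "U i"]) auto
    qed simp
  qed
qed

lemma trans_cont_L2:
  assumes [measurable]: "f \<in> borel_measurable borel" and fin: "l2sq f < \<infinity>"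
  shows "trans_cont f"
proof -
  have "l2sq (\<lambda>x. max 0 (f x)) \<le> l2sq f" "l2sq (\<lambda>x. max 0 (- f x)) \<le> l2sq f"
    by (rule l2sq_mono; simp)+
  then have "trans_cont (\<lambda>x. max 0 (f x))" "trans_cont (\<lambda>x. max 0 (- f x))"
    using fin by (intro trans_cont_L2_nonneg[THEN mp]; simp add: le_less_trans)+
  then have "trans_cont (\<lambda>x. max 0 (f x) + (- 1) * max 0 (- f x))"
    by (intro trans_cont_add trans_cont_cmult) auto
  moreover have "(\<lambda>x. max 0 (f x) + (- 1) * max 0 (- f x)) = f" by auto
  ultimately show ?thesis by simp
qed

text \<open>The kernel is not reflected: a kernel centred at \<open>h\<close> averages \<open>f\<close> around \<open>x + h\<close>.\<close>
definition conv :: "('a::euclidean_space \<Rightarrow> real) \<Rightarrow> ('a \<Rightarrow> real) \<Rightarrow> 'a \<Rightarrow> real" where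
  "conv k f x = (\<integral>w. k (w - x) * f w \<partial>lborel)"

text \<open>The variance of \<open>a\<close> under the probability density \<open>k\<close> is
  nonnegative and equals the right side minus the left side.\<close>

lemma Jensen_square:
  fixes k a :: "'a \<Rightarrow> real"
  assumes k: "integrable M k" "\<And>z. k z \<ge> 0" "(\<integral>z. k z \<partial>M) = 1"
    and [measurable]: "a \<in> borel_measurable M" and ka: "integrable M (\<lambda>z. k z * (a z)\<^sup>2)"
  shows "(\<integral>z. k z * a z \<partial>M)\<^sup>2 \<le> (\<integral>z. k z * (a z)\<^sup>2 \<partial>M)"
proof -
  have [measurable]: "k \<in> borel_measurable M" using k by auto
  have int: "integrable M (\<lambda>z. k z * a z)"
  proof (rule Bochner_Integration.integrable_bound)
    show "integrable M (\<lambda>z. k z + k z * (a z)\<^sup>2)" using k ka by auto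
    have "\<bar>a z\<bar> \<le> 1 + (a z)\<^sup>2" for z
      using sum_squares_bound[of 1 "\<bar>a z\<bar>"] abs_ge_zero[of "a z"] by simp
    then have "k z * \<bar>a z\<bar> \<le> k z * (1 + (a z)\<^sup>2)" for z by (intro mult_left_mono k)
    then show "AE z in M. norm (k z * a z) \<le> norm (k z + k z * (a z)\<^sup>2)"
      using k(2) by (intro AE_I2) (simp add: abs_mult algebra_simps)
  qed simp
  define m where "m = (\<integral>z. k z * a z \<partial>M)"
  have "0 \<le> (\<integral>z. k z * (a z - m)\<^sup>2 \<partial>M)"
    by (intro integral_nonneg_AE AE_I2) (simp add: k)
  also have "\<dots> = (\<integral>z. k z * (a z)\<^sup>2 - 2 * m * (k z * a z) + m\<^sup>2 * k z \<partial>M)"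
    by (intro Bochner_Integration.integral_cong) (auto simp: power2_eq_square algebra_simps)
  also have "\<dots> = (\<integral>z. k z * (a z)\<^sup>2 \<partial>M) - m\<^sup>2"
    using int ka k by (simp add: m_def[symmetric] power2_eq_square)
  finally show ?thesis by (simp add: m_def)
qed

text \<open>After the substitution w = x + z, \<open>conv k f x - f x\<close> is the
  \<open>k\<close>-average of f(x + z) - f(x). Jensen's inequality and an exchange of integrals
  bound its squared norm by the \<open>k\<close>-average of the translation errors. The bound
  \<open>C\<close> on the kernel makes the averages integrable at every single
  \<open>x\<close>.\<close>

lemma l2sq_conv_diff_le:
  fixes k f :: "'a::euclidean_space \<Rightarrow> real"
  assumes [measurable]: "k \<in> borel_measurable borel" "f \<in> borel_measurable borel"
    and k: "integrable lborel k" "\<And>z. k z \<ge> 0" "(\<integral>z. k z \<partial>lborel) = 1" "\<And>z. k z \<le> C"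
    and fin: "l2sq f < \<infinity>" and e: "e \<ge> 0"
    and near: "\<And>z. k z \<noteq> 0 \<Longrightarrow> l2sq (\<lambda>x. f (x + z) - f x) \<le> ennreal e"
  shows "l2sq (\<lambda>x. conv k f x - f x) \<le> ennreal e"
proof -
  have f2: "integrable lborel (\<lambda>x. (f x)\<^sup>2)"
    using fin by (intro integrableI_bounded) (auto simp: l2sq_def)
  have pt: "ennreal ((conv k f x - f x)\<^sup>2)
      \<le> (\<integral>\<^sup>+z. ennreal (k z * (f (x + z) - f x)\<^sup>2) \<partial>lborel)" for x
  proof -
    have f2x: "integrable lborel (\<lambda>z. (f (x + z))\<^sup>2)"
      using integrable_lborel_shift[OF f2, of x] by (simp add: add.commute)
    have kf2: "integrable lborel (\<lambda>z. k z * (f (x + z))\<^sup>2)"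
      by (rule Bochner_Integration.integrable_bound[OF integrable_mult_right[OF f2x, of C]])
        (use k in \<open>auto intro!: AE_I2 mult_right_mono simp: abs_mult intro: order_trans[OF k(4) abs_ge_self]\<close>)
    have ka: "integrable lborel (\<lambda>z. k z * (f (x + z) - f x)\<^sup>2)"
    proof (rule Bochner_Integration.integrable_bound)
      show "integrable lborel (\<lambda>z. 2 * (k z * (f (x + z))\<^sup>2) + 2 * (f x)\<^sup>2 * k z)"
        using kf2 k(1) by auto
      have "(f (x + z) - f x)\<^sup>2 \<le> 2 * (f (x + z))\<^sup>2 + 2 * (f x)\<^sup>2" for z
        using sum_squares_bound[of "f (x + z)" "- f x"] by (simp add: power2_diff)
      then have "k z * (f (x + z) - f x)\<^sup>2 \<le> k z * (2 * (f (x + z))\<^sup>2 + 2 * (f x)\<^sup>2)" for z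
        by (intro mult_left_mono k)
      then show "AE z in lborel. norm (k z * (f (x + z) - f x)\<^sup>2)
          \<le> norm (2 * (k z * (f (x + z))\<^sup>2) + 2 * (f x)\<^sup>2 * k z)"
        using k(2) by (intro AE_I2) (simp add: abs_mult algebra_simps)
    qed simp
    have kf: "integrable lborel (\<lambda>z. k z * f (x + z))"
    proof (rule Bochner_Integration.integrable_bound)
      show "integrable lborel (\<lambda>z. k z + k z * (f (x + z))\<^sup>2)" using k kf2 by auto
      have "\<bar>t\<bar> \<le> 1 + t\<^sup>2" for t :: real
        using sum_squares_bound[of 1 "\<bar>t\<bar>"] abs_ge_zero[of t] by simp
      then have "k z * \<bar>f (x + z)\<bar> \<le> k z * (1 + (f (x + z))\<^sup>2)" for z by (intro mult_left_mono k)
      then show "AE z in lborel. norm (k z * f (x + z)) \<le> norm (k z + k z * (f (x + z))\<^sup>2)"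
        using k(2) by (intro AE_I2) (simp add: abs_mult algebra_simps)
    qed simp
    have "conv k f x = (\<integral>z. k z * f (x + z) \<partial>lborel)"
      using integral_lborel_shift[of "\<lambda>w. k (w - x) * f w" x]
      by (simp add: conv_def add.commute)
    then have "conv k f x - f x = (\<integral>z. k z * (f (x + z) - f x) \<partial>lborel)"
      using kf k(1,3) by (simp add: right_diff_distrib)
    then have "(conv k f x - f x)\<^sup>2 \<le> (\<integral>z. k z * (f (x + z) - f x)\<^sup>2 \<partial>lborel)"
      using Jensen_square[OF k(1,2,3) _ ka] by simp
    also have "ennreal \<dots> = (\<integral>\<^sup>+z. ennreal (k z * (f (x + z) - f x)\<^sup>2) \<partial>lborel)"
      by (rule nn_integral_eq_integral[symmetric, OF ka]) (simp add: k)
    finally show ?thesis by (simp add: ennreal_leI)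
  qed
  have "l2sq (\<lambda>x. conv k f x - f x)
      \<le> (\<integral>\<^sup>+x. \<integral>\<^sup>+z. ennreal (k z * (f (x + z) - f x)\<^sup>2) \<partial>lborel \<partial>lborel)"
    unfolding l2sq_def by (intro nn_integral_mono pt)
  also have "\<dots> = (\<integral>\<^sup>+z. \<integral>\<^sup>+x. ennreal (k z * (f (x + z) - f x)\<^sup>2) \<partial>lborel \<partial>lborel)"
    by (rule lborel_pair.Fubini'[symmetric]) simp
  also have "\<dots> = (\<integral>\<^sup>+z. ennreal (k z) * l2sq (\<lambda>x. f (x + z) - f x) \<partial>lborel)"
    unfolding l2sq_def
    by (intro nn_integral_cong, subst nn_integral_cmult[symmetric]) (auto simp: k ennreal_mult)
  also have "\<dots> \<le> (\<integral>\<^sup>+z. ennreal (k z) * ennreal e \<partial>lborel)"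
  proof (intro nn_integral_mono)
    fix z show "ennreal (k z) * l2sq (\<lambda>x. f (x + z) - f x) \<le> ennreal (k z) * ennreal e"
      using near[of z] by (cases "k z = 0") (auto intro: mult_left_mono)
  qed
  also have "\<dots> = (\<integral>\<^sup>+z. ennreal (k z) \<partial>lborel) * ennreal e"
    by (rule nn_integral_multc) simp
  also have "(\<integral>\<^sup>+z. ennreal (k z) \<partial>lborel) = 1"
    using nn_integral_eq_integral[OF k(1)] k by simp
  finally show ?thesis by simp
qed

section \<open>Differentiation of convolutions\<close>

lemma borel_smooth: "smooth_fun f \<Longrightarrow> f \<in> borel_measurable borel"
  by (intro borel_measurable_continuous_onI smooth_continuous_on)

lemma bounded_support_bound:
  fixes f :: "'a::euclidean_space \<Rightarrow> real"
  assumes "continuous_on UNIV f" "\<And>z. z \<notin> cball p R \<Longrightarrow> f z = 0"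
  shows "\<exists>C\<ge>0. \<forall>x. \<bar>f x\<bar> \<le> C"
proof -
  have "compact (f ` cball p R)"
    by (intro compact_continuous_image compact_cball) (meson assms(1) continuous_on_subset subset_UNIV)
  then obtain C where "C > 0" "\<And>y. y \<in> f ` cball p R \<Longrightarrow> norm y \<le> C"
    using compact_imp_bounded bounded_pos by metis
  then show ?thesis using assms(2) by (intro exI[of _ C]) (metis abs_zero imageI less_imp_le real_norm_def)
qed

text \<open>On the ball |F| \<le> 1 + F^2, where the constant is integrable because the ball has
  finite measure; elsewhere the product vanishes.\<close>

lemma integrable_mult_L2:
  fixes c F :: "'a::euclidean_space \<Rightarrow> real"
  assumes [measurable]: "c \<in> borel_measurable borel" "F \<in> borel_measurable borel"
    and c: "\<And>x. \<bar>c x\<bar> \<le> C" "\<And>z. z \<notin> cball p R \<Longrightarrow> c z = 0" and fin: "l2sq F < \<infinity>"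
  shows "integrable lborel (\<lambda>x. c x * F x)"
proof (rule Bochner_Integration.integrable_bound)
  have "integrable lborel (\<lambda>x. (F x)\<^sup>2)"
    using fin by (intro integrableI_bounded) (auto simp: l2sq_def)
  then show "integrable lborel (\<lambda>x. C * (indicator (cball p R) x + (F x)\<^sup>2))"
    by (intro integrable_mult_right Bochner_Integration.integrable_add)
      (auto intro!: integrable_real_indicator emeasure_bounded_finite)
  have "\<bar>c x * F x\<bar> \<le> C * (indicator (cball p R) x + (F x)\<^sup>2)" for x
  proof (cases "x \<in> cball p R")
    case True
    have "\<bar>F x\<bar> \<le> 1 + (F x)\<^sup>2"
      using sum_squares_bound[of 1 "\<bar>F x\<bar>"] abs_ge_zero[of "F x"] by simp
    then show ?thesis
      using c(1)[of x] True by (auto simp: abs_mult intro!: mult_mono)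
  next
    case False
    have "C \<ge> 0" using c(1)[of x] by simp
    then show ?thesis using c(2)[OF False] by simp
  qed
  then show "AE x in lborel. norm (c x * F x) \<le> norm (C * (indicator (cball p R) x + (F x)\<^sup>2))"
    by (intro AE_I2) (metis abs_ge_self order_trans real_norm_def)
qed simp

lemma integrable_bounded_support:
  fixes f :: "'a::euclidean_space \<Rightarrow> real"
  assumes f: "continuous_on UNIV f" "\<And>z. z \<notin> cball p R \<Longrightarrow> f z = 0"
  shows "integrable lborel f"
proof -
  obtain C where C: "C \<ge> 0" "\<And>x. \<bar>f x\<bar> \<le> C"
    using bounded_support_bound[OF f] by blast
  have "integrable lborel (\<lambda>x. C * indicator (cball p R) x)"
    by (auto intro!: integrable_real_indicator emeasure_bounded_finite)
  moreover have "f \<in> borel_measurable lborel"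
    using f(1) by (simp add: borel_measurable_continuous_onI)
  moreover
  have "\<bar>f x\<bar> \<le> \<bar>C * indicator (cball p R) x\<bar>" for x
    using f(2)[of x] C by (cases "x \<in> cball p R") auto
  then have "AE x in lborel. norm (f x) \<le> norm (C * indicator (cball p R) x)"
    by simp
  ultimately show ?thesis by (rule Bochner_Integration.integrable_bound)
qed

lemma uniform_continuity_bounded_support:
  fixes f :: "'a::euclidean_space \<Rightarrow> real"
  assumes f: "continuous_on UNIV f" "\<And>z. z \<notin> cball p R \<Longrightarrow> f z = 0" and "e > 0"
  shows "\<exists>d>0. \<forall>x y. dist x y < d \<longrightarrow> \<bar>f x - f y\<bar> < e"
proof -
  \<comment> \<open>The margin 1 matches the bound \<open>min d 1\<close> below: if one of two such
    close points lies in the ball of radius \<open>R\<close>, both lie in the larger ball, and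
    otherwise both values are 0.\<close>
  have "uniformly_continuous_on (cball p (R + 1)) f"
    by (intro compact_uniformly_continuous compact_cball) (meson f(1) continuous_on_subset subset_UNIV)
  then obtain d where d: "d > 0"
    "\<And>x y. x \<in> cball p (R + 1) \<Longrightarrow> y \<in> cball p (R + 1) \<Longrightarrow> dist y x < d \<Longrightarrow> dist (f y) (f x) < e"
    using \<open>e > 0\<close> unfolding uniformly_continuous_on_def by blast
  show ?thesis
  proof (intro exI[of _ "min d 1"] conjI allI impI)
    fix x y :: 'a assume xy: "dist x y < min d 1"
    have le: "dist p x \<le> dist p y + dist x y" "dist p y \<le> dist p x + dist x y"
      by (metis dist_commute dist_triangle)+
    show "\<bar>f x - f y\<bar> < e"
    proof (cases "x \<in> cball p R \<or> y \<in> cball p R")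
      case True
      then have "x \<in> cball p (R + 1)" "y \<in> cball p (R + 1)" using le xy by auto
      then show ?thesis using d(2)[of y x] xy by (simp add: dist_real_def)
    next
      case False
      then show ?thesis using f(2)[of x] f(2)[of y] \<open>e > 0\<close> by auto
    qed
  qed (use d in auto)
qed

lemma dir_deriv_support:
  fixes k :: "'a::euclidean_space \<Rightarrow> real"
  assumes "\<And>z. z \<notin> cball p R \<Longrightarrow> k z = 0" "z \<notin> cball p R"
  shows "dir_deriv k b z = 0"
  by (rule dir_deriv_eq_0[where U = "- cball p R" and c = 0]) (use assms in auto)

text \<open>The partial derivatives have bounded support, hence are uniformly continuous, and the
  mean value inequality on the segment from \<open>z\<close> to \<open>z + h\<close> does the rest.
  Uniformity in \<open>z\<close> is what allows differentiation under the integral sign.\<close>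

lemma smooth_uniform_linearization:
  fixes k :: "'a::euclidean_space \<Rightarrow> real"
  assumes k: "smooth_fun k" "\<And>z. z \<notin> cball p R \<Longrightarrow> k z = 0" and e: "e > 0"
  shows "\<exists>d>0. \<forall>z h. norm h < d \<longrightarrow>
    \<bar>k (z + h) - k z - (\<Sum>b\<in>Basis. (h \<bullet> b) * dir_deriv k b z)\<bar> \<le> e * norm h"
proof -
  \<comment> \<open>The operator norm of the difference of two derivatives is bounded by the sum of
    its \<open>DIM('a)\<close> coordinate differences.\<close>
  let ?e = "e / DIM('a)"
  have "\<forall>b\<in>Basis. \<exists>d>0. \<forall>x y. dist x y < d \<longrightarrow> \<bar>dir_deriv k b x - dir_deriv k b y\<bar> < ?e"
    using e by (intro ballI uniform_continuity_bounded_support smooth_continuous_on smooth_dir_deriv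
        dir_deriv_support k) auto
  then obtain d where d: "\<And>b. b \<in> Basis \<Longrightarrow> d b > 0"
    "\<And>b x y. b \<in> Basis \<Longrightarrow> dist x y < d b \<Longrightarrow> \<bar>dir_deriv k b x - dir_deriv k b y\<bar> < ?e"
    using bchoice[of Basis "\<lambda>b d. d > 0 \<and> (\<forall>x y. dist x y < d \<longrightarrow> \<bar>dir_deriv k b x - dir_deriv k b y\<bar> < ?e)"]
    by blast
  define d0 where "d0 = Min (d ` Basis)"
  have d0: "d0 > 0" "\<And>b. b \<in> Basis \<Longrightarrow> d0 \<le> d b"
    using d(1) by (auto simp: d0_def)
  show ?thesis
  proof (intro exI[of _ d0] conjI allI impI d0(1))
    fix z h :: 'a assume h: "norm h < d0"
    have "norm (k (z + h) - k z - frechet_derivative k (at z) (z + h - z)) \<le> norm (z + h - z) * e"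
    proof (rule differentiable_bound_linearization[where S = "ball z d0" and f' = "\<lambda>x. frechet_derivative k (at x)"])
      show "z + t *\<^sub>R (z + h - z) \<in> ball z d0" if "t \<in> {0..1}" for t
      proof -
        have "t * norm h \<le> 1 * norm h" using that by (intro mult_right_mono) auto
        then show ?thesis using h that by (simp add: dist_norm)
      qed
      show "(k has_derivative frechet_derivative k (at x)) (at x within ball z d0)" for x
        by (rule has_derivative_at_withinI[OF smooth_has_derivative[OF k(1)]])
      show "onorm (frechet_derivative k (at x) - frechet_derivative k (at z)) \<le> e" if "x \<in> ball z d0" for x
      proof (rule onorm_le)
        fix v :: 'a
        have "norm ((frechet_derivative k (at x) - frechet_derivative k (at z)) v)
            = \<bar>\<Sum>b\<in>Basis. (v \<bullet> b) * (dir_deriv k b x - dir_deriv k b z)\<bar>"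
          by (simp add: frechet_derivative_eq_sum[OF k(1)] sum_subtractf right_diff_distrib)
        also have "\<dots> \<le> (\<Sum>b\<in>Basis. \<bar>(v \<bullet> b) * (dir_deriv k b x - dir_deriv k b z)\<bar>)"
          by (rule sum_abs)
        also have "\<dots> \<le> (\<Sum>b\<in>(Basis::'a set). norm v * ?e)"
        proof (rule sum_mono)
          fix b :: 'a assume b: "b \<in> Basis"
          have "\<bar>dir_deriv k b x - dir_deriv k b z\<bar> \<le> ?e"
            using that d0(2)[OF b] by (intro less_imp_le d(2)[OF b]) (simp add: dist_commute)
          then show "\<bar>(v \<bullet> b) * (dir_deriv k b x - dir_deriv k b z)\<bar> \<le> norm v * ?e"
            unfolding abs_mult using Basis_le_norm[OF b] by (intro mult_mono) auto
        qed
        also have "\<dots> = e * norm v" by simp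
        finally show "norm ((frechet_derivative k (at x) - frechet_derivative k (at z)) v) \<le> e * norm v" .
      qed
    qed (use d0 in auto)
    then show "\<bar>k (z + h) - k z - (\<Sum>b\<in>Basis. (h \<bullet> b) * dir_deriv k b z)\<bar> \<le> e * norm h"
      by (simp add: frechet_derivative_eq_sum[OF k(1)] mult.commute)
  qed
qed

lemma integrable_conv_kernel:
  fixes k f :: "'a::euclidean_space \<Rightarrow> real"
  assumes k: "smooth_fun k" "\<And>z. z \<notin> cball p R \<Longrightarrow> k z = 0" and f: "integrable lborel f"
  shows "integrable lborel (\<lambda>w. k (w - x) * f w)"
proof -
  have [measurable]: "f \<in> borel_measurable borel" "k \<in> borel_measurable borel"
    using borel_measurable_integrable[OF f] borel_smooth[OF k(1)] by auto
  obtain C where C: "\<And>x. \<bar>k x\<bar> \<le> C"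
    using bounded_support_bound[OF smooth_continuous_on[OF k(1)] k(2)] by blast
  show ?thesis
    by (rule Bochner_Integration.integrable_bound[OF integrable_mult_right[OF integrable_abs[OF f], of C]])
      (auto intro!: AE_I2 mult_right_mono order_trans[OF C abs_ge_self] simp: abs_mult)
qed

text \<open>The variable enters the kernel as w - x, hence the minus sign. The remainder of the
  linearized kernel is small uniformly in \<open>w\<close>, so integrating it against |f| costs only
  the factor \<open>J\<close>.\<close>

lemma conv_has_derivative:
  fixes k f :: "'a::euclidean_space \<Rightarrow> real"
  assumes k: "smooth_fun k" "\<And>z. z \<notin> cball p R \<Longrightarrow> k z = 0" and f: "integrable lborel f"
  shows "(conv k f has_derivative (\<lambda>h. - (\<Sum>b\<in>Basis. (h \<bullet> b) * conv (dir_deriv k b) f x))) (at x)"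
  unfolding has_derivative_at_alt
proof (intro conjI allI impI)
  show "bounded_linear (\<lambda>h. - (\<Sum>b\<in>Basis. (h \<bullet> b) * conv (dir_deriv k b) f x))"
    by (intro bounded_linear_minus bounded_linear_sum bounded_linear_mult_const bounded_linear_inner_left)
  fix e :: real assume e: "e > 0"
  define J where "J = (\<integral>w. \<bar>f w\<bar> \<partial>lborel)"
  have J: "J \<ge> 0" by (simp add: J_def)
  \<comment> \<open>Dividing by \<open>1 + J\<close> instead of \<open>J\<close> covers the case
    \<open>J = 0\<close>.\<close>
  have "e / (1 + J) > 0" using e J by simp
  from smooth_uniform_linearization[OF k this] obtain d where d: "d > 0"
    "\<And>z h. norm h < d \<Longrightarrow> \<bar>k (z + h) - k z - (\<Sum>b\<in>Basis. (h \<bullet> b) * dir_deriv k b z)\<bar> \<le> e / (1 + J) * norm h"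
    by blast
  have intk: "integrable lborel (\<lambda>w. k (w - y) * f w)" for y
    by (rule integrable_conv_kernel[OF k f])
  have intd: "integrable lborel (\<lambda>w. dir_deriv k b (w - y) * f w)" if "b \<in> Basis" for b y
    by (rule integrable_conv_kernel[OF smooth_dir_deriv[OF k(1) that] dir_deriv_support[OF k(2)] f])
  show "\<exists>d>0. \<forall>y. norm (y - x) < d \<longrightarrow>
      norm (conv k f y - conv k f x - - (\<Sum>b\<in>Basis. ((y - x) \<bullet> b) * conv (dir_deriv k b) f x)) \<le> e * norm (y - x)"
  proof (intro exI[of _ d] conjI allI impI d(1))
    fix y :: 'a assume y: "norm (y - x) < d"
    let ?r = "\<lambda>w. k (w - x + (x - y)) - k (w - x) - (\<Sum>b\<in>Basis. ((x - y) \<bullet> b) * dir_deriv k b (w - x))"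
    have eq: "?r w * f w = k (w - y) * f w - k (w - x) * f w - (\<Sum>b\<in>Basis. ((x - y) \<bullet> b) * (dir_deriv k b (w - x) * f w))" for w
      by (simp add: left_diff_distrib sum_distrib_right mult.assoc)
    have ints: "integrable lborel (\<lambda>w. \<Sum>b\<in>Basis. ((x - y) \<bullet> b) * (dir_deriv k b (w - x) * f w))"
      by (intro Bochner_Integration.integrable_sum integrable_mult_right intd)
    have intr: "integrable lborel (\<lambda>w. ?r w * f w)"
      unfolding eq by (intro Bochner_Integration.integrable_diff ints intk)
    have "conv k f y - conv k f x - (\<Sum>b\<in>Basis. ((x - y) \<bullet> b) * conv (dir_deriv k b) f x) = (\<integral>w. ?r w * f w \<partial>lborel)"
      unfolding eq conv_def
        Bochner_Integration.integral_diff[OF Bochner_Integration.integrable_diff[OF intk intk] ints]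
        Bochner_Integration.integral_diff[OF intk intk]
      by (subst Bochner_Integration.integral_sum) (intro integrable_mult_right intd, assumption, simp)
    moreover have "(\<Sum>b\<in>Basis. ((x - y) \<bullet> b) * conv (dir_deriv k b) f x)
        = - (\<Sum>b\<in>Basis. ((y - x) \<bullet> b) * conv (dir_deriv k b) f x)"
      by (simp add: sum_negf[symmetric] inner_diff_left algebra_simps)
    ultimately have "norm (conv k f y - conv k f x - - (\<Sum>b\<in>Basis. ((y - x) \<bullet> b) * conv (dir_deriv k b) f x))
        = norm (\<integral>w. ?r w * f w \<partial>lborel)" by simp
    also have "\<dots> \<le> (\<integral>w. norm (?r w * f w) \<partial>lborel)" by (rule integral_norm_bound)
    also have "\<dots> \<le> (\<integral>w. e / (1 + J) * norm (x - y) * \<bar>f w\<bar> \<partial>lborel)"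
    proof (rule integral_mono)
      show "norm (?r w * f w) \<le> e / (1 + J) * norm (x - y) * \<bar>f w\<bar>" for w
        unfolding real_norm_def abs_mult
        by (intro mult_right_mono d) (use y in \<open>simp_all add: norm_minus_commute\<close>)
    qed (use intr f in \<open>auto intro: integrable_norm\<close>)
    also have "\<dots> = e * (J / (1 + J)) * norm (y - x)"
      by (simp add: J_def norm_minus_commute)
    also have "\<dots> \<le> e * 1 * norm (y - x)"
      using e J by (intro mult_left_mono mult_right_mono) auto
    finally show "norm (conv k f y - conv k f x - - (\<Sum>b\<in>Basis. ((y - x) \<bullet> b) * conv (dir_deriv k b) f x))
        \<le> e * norm (y - x)" by simp
  qed
qed

lemma dir_deriv_conv:
  fixes k f :: "'a::euclidean_space \<Rightarrow> real"
  assumes "smooth_fun k" "\<And>z. z \<notin> cball p R \<Longrightarrow> k z = 0" "integrable lborel f" "b \<in> Basis"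
  shows "dir_deriv (conv k f) b x = - conv (dir_deriv k b) f x"
proof -
  have "dir_deriv (conv k f) b x = - (\<Sum>c\<in>Basis. (b \<bullet> c) * conv (dir_deriv k c) f x)"
    by (rule dir_deriv_eqI[OF conv_has_derivative[OF assms(1-3)]])
  also have "(\<Sum>c\<in>Basis. (b \<bullet> c) * conv (dir_deriv k c) f x)
      = (\<Sum>c\<in>Basis. if b = c then conv (dir_deriv k c) f x else 0)"
    by (intro sum.cong) (auto simp: inner_Basis assms(4))
  finally show ?thesis using assms(4) by simp
qed

text \<open>Every derivative falls on the kernel, which stays supported in the same ball. The
  induction therefore varies \<open>k\<close>, while \<open>f\<close> remains merely
  integrable.\<close>

lemma smooth_conv:
  fixes k f :: "'a::euclidean_space \<Rightarrow> real"
  assumes "smooth_fun k" "\<And>z. z \<notin> cball p R \<Longrightarrow> k z = 0" and f: "integrable lborel f"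
  shows "smooth_fun (conv k f)"
proof -
  have "ck n (conv k f)" for n
    using assms(1,2)
  proof (induction n arbitrary: k)
    case (Suc n)
    have "ck (Suc n) (conv k f) \<longleftrightarrow> (\<forall>x. conv k f differentiable (at x)) \<and>
        (\<forall>b\<in>Basis. ck n (dir_deriv (conv k f) b))"
      by (simp add: dir_deriv_def[abs_def])
    moreover have "conv k f differentiable (at x)" for x
      using conv_has_derivative[OF Suc.prems f] by (rule differentiableI)
    moreover have "ck n (dir_deriv (conv k f) b)" if b: "b \<in> Basis" for b
    proof -
      have eq: "dir_deriv (conv k f) b = (\<lambda>x. - 1 * conv (dir_deriv k b) f x)"
        using dir_deriv_conv[OF Suc.prems f b] by auto
      show ?thesis
        unfolding eq by (intro ck_mult ck_const Suc.IH smooth_dir_deriv[OF Suc.prems(1) b]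
            dir_deriv_support[OF Suc.prems(2)])
    qed
    ultimately show ?case by blast
  qed simp
  then show ?thesis by (rule ck_imp_smooth_fun)
qed

text \<open>A normalized bump. The free centre \<open>h\<close> lets one kernel translate by
  \<open>h\<close> and average at scale \<open>d\<close> simultaneously.\<close>

lemma ex_mollifier:
  fixes h :: "'a::euclidean_space"
  assumes d: "d > 0"
  shows "\<exists>k. smooth_fun k \<and> (\<forall>z. k z \<ge> 0) \<and> (\<forall>z. z \<notin> ball h d \<longrightarrow> k z = 0) \<and>
    integrable lborel k \<and> (\<integral>z. k z \<partial>lborel) = 1 \<and> (\<exists>C. \<forall>z. k z \<le> C)"
proof -
  obtain k where k: "smooth_fun k" "\<And>z. k z \<ge> 0" "\<And>z. z \<notin> ball h d \<Longrightarrow> k z = 0"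
      "\<And>z. z \<in> ball h d \<Longrightarrow> k z > 0"
    using ex_bump[OF d, of h] by blast
  have [measurable]: "k \<in> borel_measurable borel" by (rule borel_smooth[OF k(1)])
  have k0: "k z = 0" if "z \<notin> cball h d" for z using k(3) that by auto
  obtain C where C: "\<And>x. \<bar>k x\<bar> \<le> C"
    using bounded_support_bound[OF smooth_continuous_on[OF k(1)] k0] by blast
  have int: "integrable lborel k"
    by (rule integrable_bounded_support[OF smooth_continuous_on[OF k(1)] k0])
  define m where "m = (\<integral>z. k z \<partial>lborel)"
  have "m \<noteq> 0"
  proof
    assume "m = 0"
    then have "AE z in lborel. k z = 0"
      using integral_nonneg_eq_0_iff_AE[OF int] k(2) by (simp add: m_def)
    then have "AE z in lborel. z \<notin> ball h d"
      by eventually_elim (use k(4) in force)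
    then have "emeasure lborel (ball h d) = 0"
      by (subst (asm) AE_iff_measurable[of "ball h d"]) auto
    then show False using content_ball_pos[OF d, of h] by (simp add: measure_def)
  qed
  then have m: "m > 0" using k(2) by (simp add: m_def order.not_eq_order_implies_strict)
  show ?thesis
  proof (intro exI[of _ "\<lambda>z. (1 / m) * k z"] conjI allI impI)
    show "smooth_fun (\<lambda>z. (1 / m) * k z)" by (intro smooth_mult smooth_const k)
    show "(\<integral>z. (1 / m) * k z \<partial>lborel) = 1" using m by (simp flip: m_def)
    have "(1 / m) * k z \<le> (1 / m) * C" for z
      using m C[of z] by (intro mult_left_mono) auto
    then show "\<exists>C. \<forall>z. (1 / m) * k z \<le> C" by blast
  qed (use m k int in auto)
qed

text \<open>The bound on the derivatives does not depend on the ball that is cut off.\<close>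
lemma ex_cutoffs:
  assumes d: "d > 0"
  shows "\<exists>C\<ge>0. \<forall>(p::'a::euclidean_space) r. \<exists>\<theta>. smooth_fun \<theta> \<and> (\<forall>x. 0 \<le> \<theta> x \<and> \<theta> x \<le> 1) \<and>
    (\<forall>x\<in>ball p r. \<theta> x = 1) \<and> (\<forall>x. x \<notin> ball p (r + 2 * d) \<longrightarrow> \<theta> x = 0) \<and>
    (\<forall>b\<in>Basis. \<forall>x. \<bar>dir_deriv \<theta> b x\<bar> \<le> C)"
proof -
  obtain k :: "'a \<Rightarrow> real" where k: "smooth_fun k" "\<And>z. k z \<ge> 0" "\<And>z. z \<notin> ball 0 d \<Longrightarrow> k z = 0"
      "integrable lborel k" "(\<integral>z. k z \<partial>lborel) = 1"
    using ex_mollifier[OF d, of 0] by blast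
  have [measurable]: "k \<in> borel_measurable borel" by (rule borel_smooth[OF k(1)])
  have k0: "k z = 0" if "z \<notin> cball 0 d" for z using k(3) that by auto
  have intd: "integrable lborel (dir_deriv k b)" if b: "b \<in> Basis" for b
    by (rule integrable_bounded_support[OF smooth_continuous_on[OF smooth_dir_deriv[OF k(1) b]]
          dir_deriv_support[OF k0]])
  \<comment> \<open>The sum of the L1 norms of the partial derivatives of the kernel. Only the
    kernel enters, and translating it does not change these norms; this makes the bound the same for
    all \<open>p\<close> and \<open>r\<close>.\<close>
  define C where "C = (\<Sum>b\<in>Basis. \<integral>w. \<bar>dir_deriv k b w\<bar> \<partial>lborel)"
  have shift: "(\<integral>w. \<bar>F (w - x)\<bar> \<partial>lborel) = (\<integral>w. \<bar>F w\<bar> \<partial>lborel)" "integrable lborel (\<lambda>w. F (w - x))"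
    if "integrable lborel F" for F :: "'a \<Rightarrow> real" and x
  proof -
    have [measurable]: "F \<in> borel_measurable borel" using borel_measurable_integrable[OF that] by simp
    show "(\<integral>w. \<bar>F (w - x)\<bar> \<partial>lborel) = (\<integral>w. \<bar>F w\<bar> \<partial>lborel)"
      using integral_lborel_shift[of "\<lambda>w. \<bar>F w\<bar>" "- x"] by simp
    show "integrable lborel (\<lambda>w. F (w - x))"
      using integrable_lborel_shift[OF that, of "- x"] by simp
  qed
  have "C \<ge> 0" unfolding C_def by (intro sum_nonneg) simp
  moreover have "\<exists>\<theta>. smooth_fun \<theta> \<and> (\<forall>x. 0 \<le> \<theta> x \<and> \<theta> x \<le> 1) \<and>
    (\<forall>x\<in>ball p r. \<theta> x = 1) \<and> (\<forall>x. x \<notin> ball p (r + 2 * d) \<longrightarrow> \<theta> x = 0) \<and>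
    (\<forall>b\<in>Basis. \<forall>x. \<bar>dir_deriv \<theta> b x\<bar> \<le> C)" for p :: 'a and r
  proof -
    \<comment> \<open>The jump sits halfway between radius \<open>r\<close> and radius
      \<open>r + 2 * d\<close>: a kernel of radius \<open>d\<close> sees only the value 1 from the
      inner ball and only 0 from outside the outer one.\<close>
    let ?f = "indicator (ball p (r + d)) :: 'a \<Rightarrow> real"
    have f: "integrable lborel ?f"
      by (auto intro!: integrable_real_indicator emeasure_bounded_finite)
    have kf: "integrable lborel (\<lambda>w. k (w - x) * ?f w)" for x
      by (rule integrable_conv_kernel[OF k(1) k0 f])
    have k1: "(\<integral>w. k (w - x) \<partial>lborel) = 1" for x
      using shift(1)[OF k(4), of x] k(2,5) by simp
    have "conv k ?f x \<ge> 0" for x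
      unfolding conv_def by (intro integral_nonneg_AE AE_I2) (simp add: k)
    moreover have "conv k ?f x \<le> 1" for x
    proof -
      have "conv k ?f x \<le> (\<integral>w. k (w - x) \<partial>lborel)"
        unfolding conv_def by (intro integral_mono kf shift k(4)) (simp add: k indicator_def)
      then show ?thesis by (simp add: k1)
    qed
    moreover have "conv k ?f x = 1" if x: "x \<in> ball p r" for x
    proof -
      have "k (w - x) * ?f w = k (w - x)" for w
      proof (cases "w - x \<in> ball 0 d")
        case True
        have "dist p w \<le> dist p x + dist x w" by (rule dist_triangle)
        then have "w \<in> ball p (r + d)" using True x by (simp add: dist_norm norm_minus_commute)
        then show ?thesis by simp
      qed (simp add: k(3))
      then show ?thesis unfolding conv_def by (simp only: k1)
    qed
    moreover have "conv k ?f x = 0" if x: "x \<notin> ball p (r + 2 * d)" for x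
    proof -
      have "k (w - x) * ?f w = 0" for w
      proof (cases "w - x \<in> ball 0 d")
        case True
        have "dist p x \<le> dist p w + dist w x" by (rule dist_triangle)
        then have "w \<notin> ball p (r + d)" using True x by (simp add: dist_norm norm_minus_commute)
        then show ?thesis by simp
      qed (simp add: k(3))
      then show ?thesis unfolding conv_def by (simp only: integral_zero)
    qed
    moreover have "\<bar>dir_deriv (conv k ?f) b x\<bar> \<le> C" if b: "b \<in> Basis" for b x
    proof -
      have "\<bar>dir_deriv (conv k ?f) b x\<bar> = \<bar>\<integral>w. dir_deriv k b (w - x) * ?f w \<partial>lborel\<bar>"
        unfolding conv_def[symmetric] abs_minus_cancel[of "conv (dir_deriv k b) ?f x", symmetric]
        by (rule arg_cong[where f = abs], rule dir_deriv_conv[OF k(1) k0 f b])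
      also have "\<dots> \<le> (\<integral>w. \<bar>dir_deriv k b (w - x) * ?f w\<bar> \<partial>lborel)"
        using integral_norm_bound[of lborel "\<lambda>w. dir_deriv k b (w - x) * ?f w"] by simp
      also have "\<dots> \<le> (\<integral>w. \<bar>dir_deriv k b (w - x)\<bar> \<partial>lborel)"
      proof (rule integral_mono)
        have kd0: "dir_deriv k b z = 0" if "z \<notin> cball 0 d" for z
          by (rule dir_deriv_support[OF k0 that])
        show "integrable lborel (\<lambda>w. \<bar>dir_deriv k b (w - x) * ?f w\<bar>)"
          by (intro integrable_abs integrable_conv_kernel[OF smooth_dir_deriv[OF k(1) b] kd0 f])
        show "integrable lborel (\<lambda>w. \<bar>dir_deriv k b (w - x)\<bar>)"
          by (intro integrable_abs shift intd[OF b])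
      qed (simp add: indicator_def)
      also have "\<dots> = (\<integral>w. \<bar>dir_deriv k b w\<bar> \<partial>lborel)"
        by (rule shift[OF intd[OF b]])
      also have "\<dots> \<le> C"
        unfolding C_def using b
        by (intro member_le_sum[of b _ "\<lambda>b. \<integral>w. \<bar>dir_deriv k b w\<bar> \<partial>lborel"]) auto
      finally show ?thesis .
    qed
    ultimately show ?thesis
      by (intro exI[of _ "conv k ?f"] conjI allI ballI impI smooth_conv[OF k(1) k0 f])
  qed
  ultimately show ?thesis by blast
qed

subsection \<open>Density under the segment condition\<close>

text \<open>One shift \<open>h\<close> must serve all points of \<open>Q\<close> near
  \<open>p\<close>, and a full ball about the shifted point must fit into \<open>Q\<close>; this
  ball takes the support of the mollifier. Since only points of \<open>Q\<close> itself are moved,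
  the condition holds vacuously away from \<open>Q\<close>.\<close>

definition segment_at :: "'a::euclidean_space set \<Rightarrow> 'a \<Rightarrow> real \<Rightarrow> bool" where
  "segment_at Q p r \<longleftrightarrow> (\<forall>\<eta>>0. \<exists>h d. norm h < \<eta> \<and> 0 < d \<and> d < \<eta> \<and>
     (\<forall>x\<in>Q \<inter> ball p r. cball (x + h) d \<subseteq> Q))"

lemma l2sq_bounded_mult:
  assumes [measurable]: "F \<in> borel_measurable borel"
    and c: "\<And>x. \<bar>c x\<bar> \<le> C" and fin: "l2sq F < \<infinity>"
  shows "l2sq (\<lambda>x. c x * F x) < \<infinity>"
proof -
  have "l2sq (\<lambda>x. c x * F x) \<le> l2sq (\<lambda>x. C * F x)"
    by (rule l2sq_mono) (auto simp: abs_mult intro!: mult_right_mono order_trans[OF c abs_ge_self])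
  also have "\<dots> < \<infinity>" using fin by (simp add: l2sq_cmult ennreal_mult_less_top)
  finally show ?thesis .
qed

lemma l2sq_add_finite:
  assumes "F \<in> borel_measurable borel" "G \<in> borel_measurable borel" "l2sq F < \<infinity>" "l2sq G < \<infinity>"
  shows "l2sq (\<lambda>x. F x + G x) < \<infinity>"
  by (rule le_less_trans[OF l2sq_add]) (use assms in \<open>auto simp: ennreal_mult_less_top\<close>)

lemma l2sq_tail:
  fixes F :: "'a::euclidean_space \<Rightarrow> real"
  assumes [measurable]: "F \<in> borel_measurable borel" and fin: "l2sq F < \<infinity>"
  shows "(\<lambda>n. l2sq (\<lambda>x. indicator (- ball 0 (real n)) x * F x)) \<longlonglongrightarrow> 0"
proof -
  have "(\<lambda>n. l2sq (\<lambda>x. indicator (- ball 0 (real n)) x * F x)) \<longlonglongrightarrow> (\<integral>\<^sup>+x. 0 \<partial>(lborel::'a measure))"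
    unfolding l2sq_def
  proof (rule nn_integral_dominated_convergence)
    show "AE x in lborel. ennreal ((indicator (- ball 0 (real n)) x * F x)\<^sup>2) \<le> ennreal ((F x)\<^sup>2)" for n
      by (auto simp: indicator_def)
    show "(\<integral>\<^sup>+ x. ennreal ((F x)\<^sup>2) \<partial>lborel) < \<infinity>" using fin by (simp add: l2sq_def)
    show "AE x in lborel. (\<lambda>n. ennreal ((indicator (- ball 0 (real n)) x * F x)\<^sup>2)) \<longlonglongrightarrow> 0"
    proof (rule AE_I2)
      fix x :: 'a
      obtain N where N: "norm x < real N" using reals_Archimedean2 by blast
      have "\<forall>\<^sub>F n in sequentially. ennreal ((indicator (- ball 0 (real n)) x * F x)\<^sup>2) = 0"
        using eventually_ge_at_top[of N]
        by eventually_elim (use N in \<open>auto simp: indicator_def\<close>)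
      then show "(\<lambda>n. ennreal ((indicator (- ball 0 (real n)) x * F x)\<^sup>2)) \<longlonglongrightarrow> 0"
        by (rule tendsto_eventually)
    qed
  qed auto
  then show ?thesis by simp
qed

text \<open>\<open>I\<close> collects the directions in which weak derivatives are given. All
  functions live on the whole space: a test function and its derivatives vanish off
  \<open>Q\<close>, so \<open>weak\<close> sees only values on \<open>Q\<close>, although its
  integrals are taken over the space.\<close>

locale partial_sobolev =
  fixes Q :: "'a::euclidean_space set" and I :: "'a set"
    and u :: "'a \<Rightarrow> real" and g :: "'a \<Rightarrow> 'a \<Rightarrow> real"
  assumes I: "I \<subseteq> Basis"
    and Q [measurable]: "Q \<in> sets borel"
    and u_borel [measurable]: "u \<in> borel_measurable borel"
    and g_borel [measurable]: "\<And>b. g b \<in> borel_measurable borel"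
    and u_L2: "l2sq u < \<infinity>" and g_L2: "\<And>b. l2sq (g b) < \<infinity>"
    and weak: "\<And>\<psi> b. test_fun Q \<psi> \<Longrightarrow> b \<in> I \<Longrightarrow>
      (\<integral>w. u w * dir_deriv \<psi> b w \<partial>lborel) = - (\<integral>w. g b w * \<psi> w \<partial>lborel)"
begin

text \<open>The weak derivative of the product of \<zeta> and \<open>u\<close>, as the product rule
  predicts it.\<close>

definition cut_deriv :: "('a \<Rightarrow> real) \<Rightarrow> 'a \<Rightarrow> 'a \<Rightarrow> real" where
  "cut_deriv \<zeta> b x = \<zeta> x * g b x + dir_deriv \<zeta> b x * u x"

text \<open>A property of the cut-off rather than of the product with \<open>u\<close>: in this form
  it is additive, which is what decomposing \<zeta> along a cover requires. A single
  \<open>v\<close> has to serve the function and all its derivatives.\<close>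

definition approx :: "('a \<Rightarrow> real) \<Rightarrow> bool" where
  "approx \<zeta> \<longleftrightarrow> (\<forall>e>0. \<exists>v. smooth_fun v \<and>
     l2sq (\<lambda>x. indicator Q x * (\<zeta> x * u x - v x)) \<le> ennreal e \<and>
     (\<forall>b\<in>I. l2sq (\<lambda>x. indicator Q x * (cut_deriv \<zeta> b x - dir_deriv v b x)) \<le> ennreal e))"

lemma cut_deriv_borel [measurable]:
  assumes "smooth_fun \<zeta>" "b \<in> Basis"
  shows "cut_deriv \<zeta> b \<in> borel_measurable borel"
proof -
  have [measurable]: "\<zeta> \<in> borel_measurable borel" "dir_deriv \<zeta> b \<in> borel_measurable borel"
    using assms by (auto intro: borel_smooth smooth_dir_deriv)
  show ?thesis unfolding cut_deriv_def[abs_def] by measurable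
qed

lemma cut_deriv_add:
  "smooth_fun \<zeta>1 \<Longrightarrow> smooth_fun \<zeta>2 \<Longrightarrow>
    cut_deriv (\<lambda>x. \<zeta>1 x + \<zeta>2 x) b x = cut_deriv \<zeta>1 b x + cut_deriv \<zeta>2 b x"
  by (simp add: cut_deriv_def dir_deriv_add algebra_simps)

lemma approx_add:
  assumes s: "smooth_fun \<zeta>1" "smooth_fun \<zeta>2" and a: "approx \<zeta>1" "approx \<zeta>2"
  shows "approx (\<lambda>x. \<zeta>1 x + \<zeta>2 x)"
  unfolding approx_def
proof (intro allI impI)
  fix e :: real assume "e > 0"
  then have e4: "e / 4 > 0" by simp
  obtain v1 where v1: "smooth_fun v1"
    "l2sq (\<lambda>x. indicator Q x * (\<zeta>1 x * u x - v1 x)) \<le> ennreal (e/4)"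
    "\<And>b. b \<in> I \<Longrightarrow> l2sq (\<lambda>x. indicator Q x * (cut_deriv \<zeta>1 b x - dir_deriv v1 b x)) \<le> ennreal (e/4)"
    using a(1) e4 unfolding approx_def by blast
  obtain v2 where v2: "smooth_fun v2"
    "l2sq (\<lambda>x. indicator Q x * (\<zeta>2 x * u x - v2 x)) \<le> ennreal (e/4)"
    "\<And>b. b \<in> I \<Longrightarrow> l2sq (\<lambda>x. indicator Q x * (cut_deriv \<zeta>2 b x - dir_deriv v2 b x)) \<le> ennreal (e/4)"
    using a(2) e4 unfolding approx_def by blast
  have [measurable]: "\<zeta>1 \<in> borel_measurable borel" "\<zeta>2 \<in> borel_measurable borel"
      "v1 \<in> borel_measurable borel" "v2 \<in> borel_measurable borel"
    using s v1(1) v2(1) by (auto intro: borel_smooth)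
  show "\<exists>v. smooth_fun v \<and>
     l2sq (\<lambda>x. indicator Q x * ((\<zeta>1 x + \<zeta>2 x) * u x - v x)) \<le> ennreal e \<and>
     (\<forall>b\<in>I. l2sq (\<lambda>x. indicator Q x * (cut_deriv (\<lambda>x. \<zeta>1 x + \<zeta>2 x) b x - dir_deriv v b x)) \<le> ennreal e)"
  proof (intro exI[of _ "\<lambda>x. v1 x + v2 x"] conjI ballI)
    show "smooth_fun (\<lambda>x. v1 x + v2 x)" by (intro smooth_add v1 v2)
    have "l2sq (\<lambda>x. indicator Q x * (\<zeta>1 x * u x - v1 x) + indicator Q x * (\<zeta>2 x * u x - v2 x))
        \<le> ennreal (2 * (e/4) + 2 * (e/4))"
      using e4 by (intro l2sq_add_le v1 v2) auto
    then show "l2sq (\<lambda>x. indicator Q x * ((\<zeta>1 x + \<zeta>2 x) * u x - (v1 x + v2 x))) \<le> ennreal e"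
      by (simp add: algebra_simps)
    fix b assume b: "b \<in> I"
    then have bB: "b \<in> Basis" using I by blast
    have [measurable]: "cut_deriv \<zeta>1 b \<in> borel_measurable borel" "cut_deriv \<zeta>2 b \<in> borel_measurable borel"
        "dir_deriv v1 b \<in> borel_measurable borel" "dir_deriv v2 b \<in> borel_measurable borel"
      using s v1(1) v2(1) bB by (auto intro: borel_smooth smooth_dir_deriv cut_deriv_borel)
    have "l2sq (\<lambda>x. indicator Q x * (cut_deriv \<zeta>1 b x - dir_deriv v1 b x)
          + indicator Q x * (cut_deriv \<zeta>2 b x - dir_deriv v2 b x))
        \<le> ennreal (2 * (e/4) + 2 * (e/4))"
      using e4 by (intro l2sq_add_le v1 v2 b) auto
    then show "l2sq (\<lambda>x. indicator Q x * (cut_deriv (\<lambda>x. \<zeta>1 x + \<zeta>2 x) b x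
        - dir_deriv (\<lambda>x. v1 x + v2 x) b x)) \<le> ennreal e"
      by (simp add: cut_deriv_add[OF s] dir_deriv_add[OF v1(1) v2(1)] algebra_simps)
  qed
qed

text \<open>Inside the ball the mollifier centred at the small shift \<open>h\<close> only sees points of \<open>Q\<close>, so its
  product with the cut-off is an admissible test function.\<close>
lemma approx_local:
  assumes s: "smooth_fun \<zeta>" and supp: "\<And>x. x \<notin> cball p r' \<Longrightarrow> \<zeta> x = 0"
    and r: "r' < r" and seg: "segment_at Q p r"
  shows "approx \<zeta>"
  unfolding approx_def
proof (intro allI impI)
  fix e :: real assume e: "e > 0"
  have [measurable]: "\<zeta> \<in> borel_measurable borel" by (rule borel_smooth[OF s])
  obtain C where C: "\<And>x. \<bar>\<zeta> x\<bar> \<le> C"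
    using bounded_support_bound[OF smooth_continuous_on[OF s] supp] by blast
  let ?f = "\<lambda>x. \<zeta> x * u x"
  have f_int: "integrable lborel ?f"
    by (rule integrable_mult_L2[OF _ _ C supp u_L2]) auto
  have f_L2: "l2sq ?f < \<infinity>"
    by (rule l2sq_bounded_mult[OF _ C u_L2]) auto
  have fb_L2: "l2sq (cut_deriv \<zeta> b) < \<infinity>" if "b \<in> I" for b
  proof -
    have b: "b \<in> Basis" using that I by blast
    have [measurable]: "dir_deriv \<zeta> b \<in> borel_measurable borel"
      by (intro borel_smooth smooth_dir_deriv s b)
    have "dir_deriv \<zeta> b z = 0" if "z \<notin> cball p r'" for z
      by (rule dir_deriv_support[OF supp that])
    then obtain D where D: "\<And>x. \<bar>dir_deriv \<zeta> b x\<bar> \<le> D"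
      using bounded_support_bound[OF smooth_continuous_on[OF smooth_dir_deriv[OF s b]]] by blast
    show ?thesis unfolding cut_deriv_def[abs_def]
      by (intro l2sq_add_finite l2sq_bounded_mult[OF _ C g_L2] l2sq_bounded_mult[OF _ D u_L2]) auto
  qed
  obtain d0 where d0: "d0 > 0" "\<And>h. norm h < d0 \<Longrightarrow> l2sq (\<lambda>x. ?f (x + h) - ?f x) \<le> ennreal e"
    using trans_cont_L2[OF _ f_L2] e unfolding trans_cont_def by auto
  have "\<forall>b\<in>I. \<exists>d>0. \<forall>h. norm h < d \<longrightarrow> l2sq (\<lambda>x. cut_deriv \<zeta> b (x + h) - cut_deriv \<zeta> b x) \<le> ennreal e"
    using trans_cont_L2[OF cut_deriv_borel[OF s] fb_L2] e I unfolding trans_cont_def by blast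
  then obtain d1 where d1: "\<And>b. b \<in> I \<Longrightarrow> d1 b > 0"
    "\<And>b h. b \<in> I \<Longrightarrow> norm h < d1 b \<Longrightarrow> l2sq (\<lambda>x. cut_deriv \<zeta> b (x + h) - cut_deriv \<zeta> b x) \<le> ennreal e"
    using bchoice[of I "\<lambda>b d. d > 0 \<and> (\<forall>h. norm h < d \<longrightarrow>
        l2sq (\<lambda>x. cut_deriv \<zeta> b (x + h) - cut_deriv \<zeta> b x) \<le> ennreal e)"] by blast
  have finI: "finite I" using I finite_Basis finite_subset by blast
  \<comment> \<open>Besides the scales of translation continuity, \<eta> respects the gap between
    the support of \<zeta> and the ball on which the segment condition is available.\<close>
  define \<eta> where "\<eta> = Min (insert d0 (insert (r - r') (d1 ` I)))"
  have \<eta>: "\<eta> > 0" "\<eta> \<le> d0" "\<eta> \<le> r - r'" "\<And>b. b \<in> I \<Longrightarrow> \<eta> \<le> d1 b"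
  proof -
    show "\<eta> > 0" unfolding \<eta>_def using finI d0(1) d1(1) r by simp
  qed (unfold \<eta>_def, (rule Min_le; use finI in simp)+)
  then have "\<eta> / 2 > 0" by simp
  then obtain h d where h: "norm h < \<eta> / 2" and d: "0 < d" "d < \<eta> / 2"
      and in_Q: "\<And>x. x \<in> Q \<Longrightarrow> x \<in> ball p r \<Longrightarrow> cball (x + h) d \<subseteq> Q"
    using seg unfolding segment_at_def by blast
  obtain k K where k: "smooth_fun k" "\<And>z. k z \<ge> 0" "\<And>z. z \<notin> ball h d \<Longrightarrow> k z = 0"
      "integrable lborel k" "(\<integral>z. k z \<partial>lborel) = 1" "\<And>z. k z \<le> K"
    using ex_mollifier[OF d(1), of h] by blast
  have k0: "k z = 0" if "z \<notin> cball h d" for z using k(3) that by auto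
  have k_near: "norm z < \<eta>" if "k z \<noteq> 0" for z
  proof -
    have "dist h z < d" using k(3)[of z] that by auto
    moreover have "norm z \<le> norm h + dist h z"
      using norm_triangle_ineq[of h "z - h"] by (simp add: dist_norm norm_minus_commute)
    ultimately show ?thesis using h d by linarith
  qed
  have [measurable]: "k \<in> borel_measurable borel" by (rule borel_smooth[OF k(1)])
  have v: "smooth_fun (conv k ?f)" by (rule smooth_conv[OF k(1) k0 f_int])
  have dv: "dir_deriv (conv k ?f) b x = conv k (cut_deriv \<zeta> b) x" if b: "b \<in> I" and x: "x \<in> Q" for b x
  proof -
    have bB: "b \<in> Basis" using b I by blast
    define \<psi> where "\<psi> = (\<lambda>w. \<zeta> w * k (w - x))"
    have sk: "smooth_fun (\<lambda>w. k (w - x))" by (rule smooth_shift[OF k(1)])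
    have [measurable]: "dir_deriv \<zeta> b \<in> borel_measurable borel" "dir_deriv k b \<in> borel_measurable borel"
      by (intro borel_smooth smooth_dir_deriv s k bB)+
    have "{w. \<psi> w \<noteq> 0} \<subseteq> cball p r' \<inter> cball (x + h) d"
    proof
      fix w assume "w \<in> {w. \<psi> w \<noteq> 0}"
      then have "\<zeta> w \<noteq> 0" "k (w - x) \<noteq> 0" by (auto simp: \<psi>_def)
      then have "w \<in> cball p r'" "w - x \<in> cball h d" using supp k0 by blast+
      then show "w \<in> cball p r' \<inter> cball (x + h) d"
        by (simp add: dist_norm algebra_simps)
    qed
    then have cl: "closure {w. \<psi> w \<noteq> 0} \<subseteq> cball p r' \<inter> cball (x + h) d"
      by (intro closure_minimal) auto
    have "closure {w. \<psi> w \<noteq> 0} \<subseteq> Q"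
    proof (cases "x \<in> ball p r")
      case True
      then show ?thesis using in_Q[OF x] cl by blast
    next
      \<comment> \<open>Here the shifted kernel misses the support of \<zeta>: a common point would
        put \<open>x\<close> within r' + d + |h| < r of \<open>p\<close>. So \<psi> has empty
        support.\<close>
      case False
      have "w \<notin> cball p r' \<inter> cball (x + h) d" for w
      proof
        assume w: "w \<in> cball p r' \<inter> cball (x + h) d"
        have "dist p x \<le> dist p w + dist w (x + h) + dist (x + h) x"
          by (meson add_mono_thms_linordered_semiring(3) dist_triangle order_trans)
        also have "dist (x + h) x = norm h" by (simp add: dist_norm)
        finally show False using w h d \<eta>(3) False by (simp add: dist_commute)
      qed
      then show ?thesis using cl by blast
    qed
    moreover have "compact (closure {w. \<psi> w \<noteq> 0})"
      using cl by (meson bounded_Int bounded_cball bounded_subset compact_eq_bounded_closed closed_closure)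
    moreover have s\<psi>: "smooth_fun \<psi>" unfolding \<psi>_def by (intro smooth_mult s sk)
    ultimately have "test_fun Q \<psi>" by (simp add: test_fun_def)
    from weak[OF this b]
    have W: "(\<integral>w. u w * dir_deriv \<psi> b w \<partial>lborel) = - (\<integral>w. g b w * \<psi> w \<partial>lborel)" .
    \<comment> \<open>The term with the derivative of \<open>k\<close> integrates to minus the
      derivative of the convolution. The other term supplies the summand by which
      \<open>cut_deriv\<close> differs from \<zeta> times \<open>g b\<close>.\<close>
    have d\<psi>: "dir_deriv \<psi> b w = \<zeta> w * dir_deriv k b (w - x) + dir_deriv \<zeta> b w * k (w - x)" for w
      unfolding \<psi>_def by (simp add: dir_deriv_mult[OF s sk] dir_deriv_shift[OF k(1)])
    have supp_d: "dir_deriv \<zeta> b z = 0" if "z \<notin> cball p r'" for z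
      by (rule dir_deriv_support[OF supp that])
    from supp_d obtain D where D: "\<And>x. \<bar>dir_deriv \<zeta> b x\<bar> \<le> D"
      using bounded_support_bound[OF smooth_continuous_on[OF smooth_dir_deriv[OF s bB]]] by blast
    have i1: "integrable lborel (\<lambda>w. dir_deriv k b (w - x) * (\<zeta> w * u w))"
      by (rule integrable_conv_kernel[OF smooth_dir_deriv[OF k(1) bB] dir_deriv_support[OF k0] f_int])
    have i2: "integrable lborel (\<lambda>w. k (w - x) * (dir_deriv \<zeta> b w * u w))"
      by (intro integrable_conv_kernel[OF k(1) k0] integrable_mult_L2[OF _ _ D supp_d u_L2])
        auto
    have i3: "integrable lborel (\<lambda>w. k (w - x) * (\<zeta> w * g b w))"
      by (intro integrable_conv_kernel[OF k(1) k0] integrable_mult_L2[OF _ _ C supp g_L2]) auto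
    have "(\<integral>w. u w * dir_deriv \<psi> b w \<partial>lborel)
        = (\<integral>w. dir_deriv k b (w - x) * (\<zeta> w * u w) + k (w - x) * (dir_deriv \<zeta> b w * u w) \<partial>lborel)"
      by (intro Bochner_Integration.integral_cong) (auto simp: d\<psi> algebra_simps)
    also have "\<dots> = conv (dir_deriv k b) ?f x + (\<integral>w. k (w - x) * (dir_deriv \<zeta> b w * u w) \<partial>lborel)"
      unfolding conv_def by (rule Bochner_Integration.integral_add[OF i1 i2])
    finally have "- conv (dir_deriv k b) ?f x
        = (\<integral>w. g b w * \<psi> w \<partial>lborel) + (\<integral>w. k (w - x) * (dir_deriv \<zeta> b w * u w) \<partial>lborel)"
      using W by simp
    also have "(\<integral>w. g b w * \<psi> w \<partial>lborel) = (\<integral>w. k (w - x) * (\<zeta> w * g b w) \<partial>lborel)"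
      by (intro Bochner_Integration.integral_cong) (auto simp: \<psi>_def algebra_simps)
    also have "\<dots> + (\<integral>w. k (w - x) * (dir_deriv \<zeta> b w * u w) \<partial>lborel) = conv k (cut_deriv \<zeta> b) x"
      unfolding conv_def cut_deriv_def distrib_left
      by (rule Bochner_Integration.integral_add[OF i3 i2, symmetric])
    finally show ?thesis using dir_deriv_conv[OF k(1) k0 f_int bB] by simp
  qed
  have near: "l2sq (\<lambda>x. indicator Q x * (F x - V x)) \<le> ennreal e"
    if F [measurable]: "F \<in> borel_measurable borel" and fin: "l2sq F < \<infinity>"
      and V: "\<And>x. x \<in> Q \<Longrightarrow> V x = conv k F x"
      and tr: "\<And>z. norm z < \<eta> \<Longrightarrow> l2sq (\<lambda>x. F (x + z) - F x) \<le> ennreal e" for F V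
  proof -
    have "l2sq (\<lambda>x. indicator Q x * (F x - V x)) \<le> l2sq (\<lambda>x. conv k F x - F x)"
      by (rule l2sq_mono) (auto simp: indicator_def V)
    also have "\<dots> \<le> ennreal e"
      by (rule l2sq_conv_diff_le[OF _ F k(4,2,5,6) fin]) (use e k_near tr in auto)
    finally show ?thesis .
  qed
  show "\<exists>v. smooth_fun v \<and> l2sq (\<lambda>x. indicator Q x * (\<zeta> x * u x - v x)) \<le> ennreal e \<and>
     (\<forall>b\<in>I. l2sq (\<lambda>x. indicator Q x * (cut_deriv \<zeta> b x - dir_deriv v b x)) \<le> ennreal e)"
  proof (intro exI[of _ "conv k ?f"] conjI ballI v)
    show "l2sq (\<lambda>x. indicator Q x * (\<zeta> x * u x - conv k ?f x)) \<le> ennreal e"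
      by (rule near[OF _ f_L2]) (use \<eta> in \<open>auto intro!: d0(2)\<close>)
    fix b assume b: "b \<in> I"
    show "l2sq (\<lambda>x. indicator Q x * (cut_deriv \<zeta> b x - dir_deriv (conv k ?f) b x)) \<le> ennreal e"
      by (rule near[OF cut_deriv_borel[OF s] fb_L2[OF b]]) (use b I \<eta>(4)[OF b] dv in \<open>auto intro!: d1(2)\<close>)
  qed
qed

lemma approx_zero: "approx (\<lambda>x. 0)"
  unfolding approx_def
  by (intro allI impI exI[of _ "\<lambda>x. 0"])
    (simp add: smooth_const cut_deriv_def dir_deriv_const l2sq_def)

text \<open>A partition of unity built one ball at a time: \<zeta> = \<theta> \<zeta> + (1 -
  \<theta>) \<zeta>, where the second part vanishes on the current ball and is covered by the
  remaining ones. The cut-off \<theta> is 1 up to radius \<rho> and 0 beyond 2 \<rho>; the factor 3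
  leaves the strict gap that \<open>approx_local\<close> wants.\<close>

lemma approx_finite_cover:
  assumes "finite F" and F: "\<And>p. p \<in> F \<Longrightarrow> \<rho> p > 0 \<and> segment_at Q p (3 * \<rho> p)"
    and "smooth_fun \<zeta>" "\<And>x. x \<notin> (\<Union>p\<in>F. ball p (\<rho> p)) \<Longrightarrow> \<zeta> x = 0"
  shows "approx \<zeta>"
  using assms
proof (induction F arbitrary: \<zeta> rule: finite_induct)
  case empty
  then have "\<zeta> = (\<lambda>x. 0)" by auto
  then show ?case using approx_zero by simp
next
  case (insert p F)
  have \<rho>: "\<rho> p > 0" "segment_at Q p (3 * \<rho> p)" using insert.prems(1) by auto
  then have "\<rho> p / 2 > 0" by simp
  then obtain \<theta> where \<theta>: "smooth_fun \<theta>" "\<And>x. x \<in> ball p (\<rho> p) \<Longrightarrow> \<theta> x = 1"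
      "\<And>x. x \<notin> ball p (\<rho> p + 2 * (\<rho> p / 2)) \<Longrightarrow> \<theta> x = 0"
    using ex_cutoffs[of "\<rho> p / 2"] by metis
  have "approx (\<lambda>x. \<theta> x * \<zeta> x)"
  proof (rule approx_local[OF _ _ _ \<rho>(2)])
    show "smooth_fun (\<lambda>x. \<theta> x * \<zeta> x)" by (intro smooth_mult \<theta> insert.prems)
    show "\<theta> x * \<zeta> x = 0" if "x \<notin> cball p (2 * \<rho> p)" for x
      using \<theta>(3)[of x] that by auto
  qed (use \<rho> in simp)
  moreover have s2: "smooth_fun (\<lambda>x. (1 - \<theta> x) * \<zeta> x)"
    by (intro smooth_mult smooth_diff smooth_const \<theta> insert.prems)
  moreover have "approx (\<lambda>x. (1 - \<theta> x) * \<zeta> x)"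
  proof (rule insert.IH[OF _ s2])
    show "(1 - \<theta> x) * \<zeta> x = 0" if "x \<notin> (\<Union>p\<in>F. ball p (\<rho> p))" for x
      using \<theta>(2)[of x] insert.prems(3)[of x] that by (cases "x \<in> ball p (\<rho> p)") auto
  qed (use insert.prems(1) in auto)
  ultimately have "approx (\<lambda>x. \<theta> x * \<zeta> x + (1 - \<theta> x) * \<zeta> x)"
    by (intro approx_add[OF _ s2] smooth_mult \<theta> insert.prems)
  then show ?case by (simp add: algebra_simps)
qed

lemma approx_compact:
  assumes seg: "\<And>p. \<exists>r>0. segment_at Q p r"
    and s: "smooth_fun \<zeta>" and supp: "\<And>x. x \<notin> cball 0 R \<Longrightarrow> \<zeta> x = 0"
  shows "approx \<zeta>"
proof -
  obtain r where r: "\<And>p. r p > 0" "\<And>p. segment_at Q p (r p)"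
    using seg by metis
  have "x \<in> (\<Union>p. ball p (r p / 3))" for x
    by (intro UN_I[of x]) (use r(1)[of x] in auto)
  then have "cball 0 R \<subseteq> (\<Union>p. ball p (r p / 3))" by blast
  then obtain F where F: "finite F" "cball 0 R \<subseteq> (\<Union>p\<in>F. ball p (r p / 3))"
    by (rule compactE_image[OF compact_cball open_ball])
  show ?thesis
  proof (rule approx_finite_cover[OF F(1) _ s])
    show "r p / 3 > 0 \<and> segment_at Q p (3 * (r p / 3))" for p using r by simp
    show "\<zeta> x = 0" if "x \<notin> (\<Union>p\<in>F. ball p (r p / 3))" for x
      using supp[of x] F(2) that by blast
  qed
qed

text \<open>Cutting off at radius \<open>n\<close> costs (1 - \<theta>) u and (1 - \<theta>) g, and
  in the derivatives also u times a derivative of \<theta>. All of these live outside the ball of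
  radius \<open>n\<close>. Because \<open>C\<close> is fixed before \<open>n\<close>, the last one
  is bounded by a tail of \<open>C * u\<close> and is small as well.\<close>

lemma smooth_dense:
  assumes seg: "\<And>p. \<exists>r>0. segment_at Q p r" and e: "e > 0"
  shows "\<exists>v. smooth_fun v \<and> l2sq (\<lambda>x. indicator Q x * (u x - v x)) \<le> ennreal e \<and>
     (\<forall>b\<in>I. l2sq (\<lambda>x. indicator Q x * (g b x - dir_deriv v b x)) \<le> ennreal e)"
proof -
  have finI: "finite I" using I finite_Basis finite_subset by blast
  obtain C where C: "C \<ge> 0" "\<forall>(p::'a) r. \<exists>\<theta>. smooth_fun \<theta> \<and> (\<forall>x. 0 \<le> \<theta> x \<and> \<theta> x \<le> 1) \<and>
      (\<forall>x\<in>ball p r. \<theta> x = 1) \<and> (\<forall>x. x \<notin> ball p (r + 2 * 1) \<longrightarrow> \<theta> x = 0) \<and>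
      (\<forall>b\<in>Basis. \<forall>x. \<bar>dir_deriv \<theta> b x\<bar> \<le> C)"
    using ex_cutoffs[of 1] by auto
  \<comment> \<open>The sums below reach at most \<open>10 * e'\<close>.\<close>
  define e' where "e' = e / 20"
  have e': "e' > 0" using e by (simp add: e'_def)
  have tails: "(\<lambda>n. l2sq (\<lambda>x. indicator (- ball 0 (real n)) x * u x)) \<longlonglongrightarrow> 0"
    "(\<lambda>n. l2sq (\<lambda>x. indicator (- ball 0 (real n)) x * (C * u x))) \<longlonglongrightarrow> 0"
    "(\<lambda>n. l2sq (\<lambda>x. indicator (- ball 0 (real n)) x * g b x)) \<longlonglongrightarrow> 0" for b
    by (intro l2sq_tail u_L2 g_L2 l2sq_bounded_mult[of u "\<lambda>_. C" C]; use C in simp)+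
  have "\<forall>\<^sub>F n in sequentially. l2sq (\<lambda>x. indicator (- ball 0 (real n)) x * u x) < ennreal e' \<and>
     l2sq (\<lambda>x. indicator (- ball 0 (real n)) x * (C * u x)) < ennreal e' \<and>
     (\<forall>b\<in>I. l2sq (\<lambda>x. indicator (- ball 0 (real n)) x * g b x) < ennreal e')"
    by (intro eventually_conj eventually_ball_finite finI ballI order_tendstoD(2)[OF tails(1)]
        order_tendstoD(2)[OF tails(2)] order_tendstoD(2)[OF tails(3)]) (use e' in simp_all)
  then obtain n where n: "l2sq (\<lambda>x. indicator (- ball 0 (real n)) x * u x) < ennreal e'"
     "l2sq (\<lambda>x. indicator (- ball 0 (real n)) x * (C * u x)) < ennreal e'"
     "\<And>b. b \<in> I \<Longrightarrow> l2sq (\<lambda>x. indicator (- ball 0 (real n)) x * g b x) < ennreal e'"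
    using eventually_happens'[OF sequentially_bot] by blast
  from C(2)[rule_format, of 0 "real n"] obtain \<theta> :: "'a \<Rightarrow> real" where
    "smooth_fun \<theta>" "\<forall>x. 0 \<le> \<theta> x \<and> \<theta> x \<le> 1" "\<forall>x\<in>ball 0 (real n). \<theta> x = 1"
    "\<forall>x. x \<notin> ball 0 (real n + 2 * 1) \<longrightarrow> \<theta> x = 0" "\<forall>b\<in>Basis. \<forall>x. \<bar>dir_deriv \<theta> b x\<bar> \<le> C"
    by (elim exE conjE)
  then have \<theta>: "smooth_fun \<theta>" "\<And>x. 0 \<le> \<theta> x \<and> \<theta> x \<le> 1"
      "\<And>x. x \<in> ball 0 (real n) \<Longrightarrow> \<theta> x = 1" "\<And>x. x \<notin> ball 0 (real n + 2 * 1) \<Longrightarrow> \<theta> x = 0"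
      "\<And>b x. b \<in> Basis \<Longrightarrow> \<bar>dir_deriv \<theta> b x\<bar> \<le> C"
    by blast+
  have [measurable]: "\<theta> \<in> borel_measurable borel" by (rule borel_smooth[OF \<theta>(1)])
  have "approx \<theta>"
    by (rule approx_compact[OF seg \<theta>(1), of "real n + 2"]) (use \<theta>(4) in auto)
  then obtain v where v: "smooth_fun v"
    "l2sq (\<lambda>x. indicator Q x * (\<theta> x * u x - v x)) \<le> ennreal e'"
    "\<And>b. b \<in> I \<Longrightarrow> l2sq (\<lambda>x. indicator Q x * (cut_deriv \<theta> b x - dir_deriv v b x)) \<le> ennreal e'"
    using e' unfolding approx_def by blast
  have [measurable]: "v \<in> borel_measurable borel" by (rule borel_smooth[OF v(1)])
  have le1: "\<bar>a * (1 - \<theta> x)\<bar> \<le> \<bar>a\<bar>" for a x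
    using \<theta>(2)[of x] mult_left_mono[of "1 - \<theta> x" 1 "\<bar>a\<bar>"] by (simp add: abs_mult)
  show ?thesis
  proof (intro exI[of _ v] conjI ballI v(1))
    have "l2sq (\<lambda>x. u x * (1 - \<theta> x)) \<le> l2sq (\<lambda>x. indicator (- ball 0 (real n)) x * u x)"
      by (rule l2sq_mono) (use \<theta>(3) le1 in \<open>auto simp: indicator_def\<close>)
    then have "l2sq (\<lambda>x. u x * (1 - \<theta> x)) \<le> ennreal e'" using n(1) by order
    then have "l2sq (\<lambda>x. u x * (1 - \<theta> x) + indicator Q x * (\<theta> x * u x - v x)) \<le> ennreal (2 * e' + 2 * e')"
      using e' by (intro l2sq_add_le v) auto
    then have *: "l2sq (\<lambda>x. u x * (1 - \<theta> x) + indicator Q x * (\<theta> x * u x - v x)) \<le> ennreal e"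
      by (rule order_trans) (use e in \<open>simp add: e'_def ennreal_leI\<close>)
    have "l2sq (\<lambda>x. indicator Q x * (u x - v x))
        \<le> l2sq (\<lambda>x. u x * (1 - \<theta> x) + indicator Q x * (\<theta> x * u x - v x))"
      by (rule l2sq_mono) (auto simp: indicator_def algebra_simps)
    with * show "l2sq (\<lambda>x. indicator Q x * (u x - v x)) \<le> ennreal e" by order
    fix b assume b: "b \<in> I"
    then have bB: "b \<in> Basis" using I by blast
    have [measurable]: "dir_deriv v b \<in> borel_measurable borel" "dir_deriv \<theta> b \<in> borel_measurable borel"
        "cut_deriv \<theta> b \<in> borel_measurable borel"
      by (intro borel_smooth smooth_dir_deriv cut_deriv_borel v(1) \<theta>(1) bB)+
    have "l2sq (\<lambda>x. g b x * (1 - \<theta> x)) \<le> l2sq (\<lambda>x. indicator (- ball 0 (real n)) x * g b x)"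
      by (rule l2sq_mono) (use \<theta>(3) le1 in \<open>auto simp: indicator_def\<close>)
    then have g1: "l2sq (\<lambda>x. g b x * (1 - \<theta> x)) \<le> ennreal e'" using n(3)[OF b] by order
    have d0: "dir_deriv \<theta> b x = 0" if "x \<in> ball 0 (real n)" for x
      by (rule dir_deriv_eq_0[OF open_ball that \<theta>(3)])
    have "l2sq (\<lambda>x. dir_deriv \<theta> b x * u x) \<le> l2sq (\<lambda>x. indicator (- ball 0 (real n)) x * (C * u x))"
      by (rule l2sq_mono) (use d0 \<theta>(5)[OF bB] C(1) in \<open>auto simp: indicator_def abs_mult intro!: mult_right_mono\<close>)
    then have g2: "l2sq (\<lambda>x. dir_deriv \<theta> b x * u x) \<le> ennreal e'" using n(2) by order
    have "l2sq (\<lambda>x. g b x * (1 - \<theta> x) - dir_deriv \<theta> b x * u x) \<le> ennreal (2 * e' + 2 * e')"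
      using e' by (intro l2sq_diff_le g1 g2) auto
    then have "l2sq (\<lambda>x. (g b x * (1 - \<theta> x) - dir_deriv \<theta> b x * u x)
        + indicator Q x * (cut_deriv \<theta> b x - dir_deriv v b x)) \<le> ennreal (2 * (2 * e' + 2 * e') + 2 * e')"
      using e' by (intro l2sq_add_le v b) auto
    then have *: "l2sq (\<lambda>x. (g b x * (1 - \<theta> x) - dir_deriv \<theta> b x * u x)
        + indicator Q x * (cut_deriv \<theta> b x - dir_deriv v b x)) \<le> ennreal e"
      by (rule order_trans) (use e in \<open>simp add: e'_def ennreal_leI\<close>)
    \<comment> \<open>On \<open>Q\<close> the two functions agree, because the terms in \<theta>
      cancel against those inside \<open>cut_deriv\<close>; off \<open>Q\<close> the left one is
      0.\<close>
    have "l2sq (\<lambda>x. indicator Q x * (g b x - dir_deriv v b x))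
        \<le> l2sq (\<lambda>x. (g b x * (1 - \<theta> x) - dir_deriv \<theta> b x * u x)
        + indicator Q x * (cut_deriv \<theta> b x - dir_deriv v b x))"
      by (rule l2sq_mono) (auto simp: indicator_def cut_deriv_def algebra_simps)
    with * show "l2sq (\<lambda>x. indicator Q x * (g b x - dir_deriv v b x)) \<le> ennreal e" by order
  qed
qed

end

subsection \<open>The segment condition for the space-time domain\<close>

text \<open>Every point of a small ball about \<open>x + s *\<^sub>R y\<close> has the form
  \<open>x + s *\<^sub>R w\<close> with \<open>w\<close> close to \<open>y\<close>. Perturbing the
  direction thus replaces the ball in \<open>segment_at\<close>, and \<open>step\<close> may assume
  that the whole segment stays near \<open>p\<close>.\<close>

lemma segment_atI:
  assumes \<rho>: "\<rho> > 0"
    and step: "\<And>x w s. x \<in> Q \<Longrightarrow> w \<in> ball y \<rho> \<Longrightarrow> s > 0 \<Longrightarrow>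
      (\<And>\<tau>. 0 \<le> \<tau> \<Longrightarrow> \<tau> \<le> s \<Longrightarrow> x + \<tau> *\<^sub>R w \<in> ball p \<rho>) \<Longrightarrow> x + s *\<^sub>R w \<in> Q"
  shows "segment_at Q p (\<rho> / 2)"
  unfolding segment_at_def
proof (intro allI impI)
  fix \<eta> :: real assume \<eta>: "\<eta> > 0"
  define M where "M = norm y + \<rho>"
  have M: "M > 0" "M \<ge> \<rho>" "M > norm y" using \<rho> by (auto simp: M_def add_nonneg_pos)
  \<comment> \<open>\<open>M\<close> bounds the length of all admissible directions. The step is
    short enough that a segment starting in the half ball about \<open>p\<close> does not leave the
    full one, and \<open>s * (\<rho> / 2)\<close> is the deviation caused by |w - y| \<le> \<rho> /
    2.\<close>
  define s where "s = min \<eta> (\<rho> / 2) / (2 * M)"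
  have s: "s > 0" using \<eta> \<rho> M by (simp add: s_def)
  have "s * M = min \<eta> (\<rho> / 2) / 2" using M by (simp add: s_def)
  then have sM: "s * M < \<eta>" "s * M < \<rho> / 2" using \<eta> \<rho> by auto
  have "s * norm y < s * M" by (intro mult_strict_left_mono s M)
  then have "s * norm y < \<eta>" using sM by linarith
  then have h: "norm (s *\<^sub>R y) < \<eta>" using s by simp
  have "s * (\<rho> / 2) < s * M" using M \<rho> by (intro mult_strict_left_mono s) linarith
  then have d: "0 < s * (\<rho> / 2)" "s * (\<rho> / 2) < \<eta>" using s \<rho> sM by (simp, linarith)
  show "\<exists>h d. norm h < \<eta> \<and> 0 < d \<and> d < \<eta> \<and> (\<forall>x\<in>Q \<inter> ball p (\<rho> / 2). cball (x + h) d \<subseteq> Q)"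
  proof (intro exI conjI ballI subsetI)
    fix x z assume x: "x \<in> Q \<inter> ball p (\<rho> / 2)" and z: "z \<in> cball (x + s *\<^sub>R y) (s * (\<rho> / 2))"
    define w where "w = (1 / s) *\<^sub>R (z - x)"
    have zw: "z = x + s *\<^sub>R w" using s by (simp add: w_def)
    have "s * dist y w = dist (x + s *\<^sub>R y) z"
      using s by (simp add: zw dist_norm scaleR_diff_right[symmetric])
    also have "\<dots> \<le> s * (\<rho> / 2)" using z by simp
    finally have "dist y w \<le> \<rho> / 2" using s by simp
    then have w: "w \<in> ball y \<rho>" using \<rho> by simp
    have "norm w \<le> norm y + dist y w"
      using norm_triangle_ineq[of y "w - y"] by (simp add: dist_norm norm_minus_commute)
    then have nw: "norm w < M" using w by (simp add: M_def)
    show "z \<in> Q" unfolding zw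
    proof (rule step[OF _ w s])
      show "x \<in> Q" using x by blast
      fix \<tau> assume \<tau>: "0 \<le> \<tau>" "\<tau> \<le> s"
      have "dist p (x + \<tau> *\<^sub>R w) \<le> dist p x + norm (\<tau> *\<^sub>R w)"
        by (rule order_trans[OF dist_triangle[of _ _ x]]) (simp add: dist_norm)
      also have "norm (\<tau> *\<^sub>R w) \<le> s * M"
        using \<tau> nw by (auto intro!: mult_mono)
      finally show "x + \<tau> *\<^sub>R w \<in> ball p \<rho>" using x sM by simp
    qed
  qed (use h d in auto)
qed

definition slab :: "real \<Rightarrow> real \<Rightarrow> ('b \<times> real) set" where
  "slab t0 T = {q. t0 < snd q \<and> snd q < T}"

text \<open>An end of the time interval that \<open>p\<close> does not touch stays out of reach near
  \<open>p\<close>. At an end that \<open>p\<close> does touch, the time component of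
  \<open>w\<close> has the sign of that of \<open>y\<close>, so the motion leads away from this
  end.\<close>

lemma ex_time_radius:
  fixes p y :: "'b::euclidean_space \<times> real"
  assumes p: "t0 \<le> snd p" "snd p \<le> T"
    and y: "snd p = T \<Longrightarrow> snd y < 0" "snd p = t0 \<Longrightarrow> snd y > 0"
  shows "\<exists>\<rho>>0. \<forall>x w s. x \<in> slab t0 T \<longrightarrow> w \<in> ball y \<rho> \<longrightarrow> s > 0 \<longrightarrow> x + s *\<^sub>R w \<in> ball p \<rho> \<longrightarrow>
    x + s *\<^sub>R w \<in> slab t0 T"
proof -
  \<comment> \<open>Each 1 is a default for an absent constraint. The third entry forces
    \<open>snd w\<close> to have the sign of \<open>snd y\<close>.\<close>
  define \<rho> where "\<rho> = Min {if snd p < T then T - snd p else 1, if t0 < snd p then snd p - t0 else 1,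
    if snd y = 0 then 1 else \<bar>snd y\<bar>}"
  have \<rho>: "\<rho> > 0" "snd p < T \<Longrightarrow> \<rho> \<le> T - snd p" "t0 < snd p \<Longrightarrow> \<rho> \<le> snd p - t0"
    "snd y \<noteq> 0 \<Longrightarrow> \<rho> \<le> \<bar>snd y\<bar>"
    unfolding \<rho>_def by (auto simp: min_def)
  have near: "\<bar>snd q - snd q'\<bar> < \<rho>" if "q \<in> ball q' \<rho>" for q q' :: "'b \<times> real"
    using dist_snd_le[of q' q] that by (simp add: dist_real_def abs_minus_commute)
  show ?thesis
  proof (intro exI[of _ \<rho>] conjI allI impI \<rho>(1))
    fix x w :: "'b \<times> real" and s :: real
    assume x: "x \<in> slab t0 T" and w: "w \<in> ball y \<rho>" and s: "s > 0"
      and q: "x + s *\<^sub>R w \<in> ball p \<rho>"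
    have "snd x + s * snd w < T"
    proof (cases "snd p < T")
      case True
      then show ?thesis using \<rho>(2) near[OF q] by simp
    next
      case False
      then have "snd w < 0" using p y(1) \<rho>(4) near[OF w] by fastforce
      then have "s * snd w < 0" using s by (simp add: mult_pos_neg)
      then show ?thesis using x by (simp add: slab_def)
    qed
    moreover have "t0 < snd x + s * snd w"
    proof (cases "t0 < snd p")
      case True
      then show ?thesis using \<rho>(3) near[OF q] by simp
    next
      case False
      then have "snd w > 0" using p y(2) \<rho>(4) near[OF w] by fastforce
      then have "s * snd w > 0" using s by simp
      then show ?thesis using x by (simp add: slab_def)
    qed
    ultimately show "x + s *\<^sub>R w \<in> slab t0 T" by (simp add: slab_def)
  qed
qed

text \<open>The derivative at \<open>q\<close> along \<open>w\<close> is jointly continuous in both,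
  so it stays negative for \<open>q\<close> near \<open>p\<close> and \<open>w\<close> near
  \<open>y\<close>. Hence \<phi> decreases along all these segments, and negative values stay
  negative.\<close>

lemma segment_at_transversal:
  fixes \<phi> :: "'b::euclidean_space \<times> real \<Rightarrow> real"
  assumes \<phi>: "smooth_fun \<phi>" and p: "t0 \<le> snd p" "snd p \<le> T"
    and y: "snd p = T \<Longrightarrow> snd y < 0" "snd p = t0 \<Longrightarrow> snd y > 0"
    and neg: "frechet_derivative \<phi> (at p) y < 0"
  shows "\<exists>r>0. segment_at (slab t0 T \<inter> {q. \<phi> q < 0}) p r"
proof -
  \<comment> \<open>The directional derivative as one function on pairs of point and direction, so
    that a single open set yields the radii for both.\<close>
  define G where "G = (\<lambda>z. \<Sum>b\<in>Basis. (snd z \<bullet> b) * dir_deriv \<phi> b (fst z))"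
  have G: "G (q, w) = frechet_derivative \<phi> (at q) w" for q w
    by (simp add: G_def frechet_derivative_eq_sum[OF \<phi>])
  have "continuous_on UNIV G"
    unfolding G_def
    by (intro continuous_intros continuous_on_compose2[OF smooth_continuous_on[OF smooth_dir_deriv[OF \<phi>]]]) auto
  then have "open {z. G z < 0}" by (intro open_Collect_less continuous_on_const)
  moreover have "(p, y) \<in> {z. G z < 0}" using neg G by simp
  ultimately obtain A B where "open A" "open B" "p \<in> A" "y \<in> B" "A \<times> B \<subseteq> {z. G z < 0}"
    by (auto elim: open_prod_elim)
  then obtain r1 r2 where r: "r1 > 0" "r2 > 0" "ball p r1 \<subseteq> A" "ball y r2 \<subseteq> B"
    by (meson open_contains_ball)
  have Gneg: "frechet_derivative \<phi> (at q) w < 0" if "q \<in> ball p r1" "w \<in> ball y r2" for q w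
  proof -
    have "(q, w) \<in> A \<times> B" using that r by blast
    then have "G (q, w) < 0" using \<open>A \<times> B \<subseteq> {z. G z < 0}\<close> by blast
    then show ?thesis by (simp only: G)
  qed
  obtain r3 where r3: "r3 > 0" "\<And>x w s. x \<in> slab t0 T \<Longrightarrow> w \<in> ball y r3 \<Longrightarrow> s > 0 \<Longrightarrow>
      x + s *\<^sub>R w \<in> ball p r3 \<Longrightarrow> x + s *\<^sub>R w \<in> slab t0 T"
    using ex_time_radius[OF p y] by blast
  define \<rho> where "\<rho> = min r1 (min r2 r3)"
  have \<rho>: "\<rho> > 0" "\<rho> \<le> r1" "\<rho> \<le> r2" "\<rho> \<le> r3" using r r3 by (auto simp: \<rho>_def)
  have "segment_at (slab t0 T \<inter> {q. \<phi> q < 0}) p (\<rho> / 2)"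
  proof (rule segment_atI[OF \<rho>(1)])
    fix x w s
    assume x: "x \<in> slab t0 T \<inter> {q. \<phi> q < 0}" and w: "w \<in> ball y \<rho>" and s: "s > 0"
      and path: "\<And>\<tau>. 0 \<le> \<tau> \<Longrightarrow> \<tau> \<le> s \<Longrightarrow> x + \<tau> *\<^sub>R w \<in> ball p \<rho>"
    have "\<phi> (x + 0 *\<^sub>R w) > \<phi> (x + s *\<^sub>R w)"
    proof (rule DERIV_neg_imp_decreasing[OF s])
      fix \<tau> :: real assume \<tau>: "0 \<le> \<tau>" "\<tau> \<le> s"
      let ?q = "x + \<tau> *\<^sub>R w"
      have D: "((\<lambda>\<tau>. \<phi> (x + \<tau> *\<^sub>R w)) has_derivative (\<lambda>h. frechet_derivative \<phi> (at ?q) (h *\<^sub>R w))) (at \<tau>)"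
        by (rule has_derivative_compose[OF _ smooth_has_derivative[OF \<phi>]]) (auto intro!: derivative_eq_intros)
      have "((\<lambda>\<tau>. \<phi> (x + \<tau> *\<^sub>R w)) has_real_derivative frechet_derivative \<phi> (at ?q) w) (at \<tau>)"
        by (rule has_derivative_imp_has_field_derivative[OF D])
          (simp add: linear_cmul[OF has_derivative_linear[OF smooth_has_derivative[OF \<phi>]]])
      moreover have "frechet_derivative \<phi> (at ?q) w < 0"
        using path[OF \<tau>] w \<rho> by (intro Gneg) auto
      ultimately show "\<exists>D. ((\<lambda>\<tau>. \<phi> (x + \<tau> *\<^sub>R w)) has_real_derivative D) (at \<tau>) \<and> D < 0" by blast
    qed
    moreover have "x + s *\<^sub>R w \<in> slab t0 T"
      using x w path[of s] s \<rho> by (intro r3(2)) auto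
    ultimately show "x + s *\<^sub>R w \<in> slab t0 T \<inter> {q. \<phi> q < 0}" using x by simp
  qed
  then show ?thesis using \<rho>(1) by (intro exI[of _ "\<rho> / 2"]) auto
qed

text \<open>This covers points of the time slices \<open>t0\<close> and \<open>T\<close> where \<open>\<phi>\<close> may vanish, even with vanishing
  derivative, without being approached by the lateral boundary.\<close>
lemma segment_at_flat:
  fixes \<phi> :: "'b::euclidean_space \<times> real \<Rightarrow> real"
  assumes p: "t0 \<le> snd p" "snd p \<le> T" and "t0 < T"
    and r: "r > 0" "\<And>q. q \<in> ball p r \<Longrightarrow> q \<in> slab t0 T \<Longrightarrow> \<phi> q < 0"
  shows "\<exists>r>0. segment_at (slab t0 T \<inter> {q. \<phi> q < 0}) p r"
proof -
  define y :: "'b \<times> real" where "y = (0, if snd p = T then -1 else 1)"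
  have y: "snd p = T \<Longrightarrow> snd y < 0" "snd p = t0 \<Longrightarrow> snd y > 0"
    using \<open>t0 < T\<close> by (auto simp: y_def)
  obtain r3 where r3: "r3 > 0" "\<And>x w s. x \<in> slab t0 T \<Longrightarrow> w \<in> ball y r3 \<Longrightarrow> s > 0 \<Longrightarrow>
      x + s *\<^sub>R w \<in> ball p r3 \<Longrightarrow> x + s *\<^sub>R w \<in> slab t0 T"
    using ex_time_radius[OF p y] by blast
  define \<rho> where "\<rho> = min r r3"
  have \<rho>: "\<rho> > 0" "\<rho> \<le> r" "\<rho> \<le> r3" using r r3 by (auto simp: \<rho>_def)
  have "segment_at (slab t0 T \<inter> {q. \<phi> q < 0}) p (\<rho> / 2)"
  proof (rule segment_atI[OF \<rho>(1), where y = y])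
    fix x w s
    assume x: "x \<in> slab t0 T \<inter> {q. \<phi> q < 0}" and w: "w \<in> ball y \<rho>" and s: "s > 0"
      and path: "\<And>\<tau>. 0 \<le> \<tau> \<Longrightarrow> \<tau> \<le> s \<Longrightarrow> x + \<tau> *\<^sub>R w \<in> ball p \<rho>"
    have q: "x + s *\<^sub>R w \<in> ball p \<rho>" using path[of s] s by simp
    have "x + s *\<^sub>R w \<in> slab t0 T"
      using x w q s \<rho> by (intro r3(2)) auto
    moreover from r(2)[OF _ this] have "\<phi> (x + s *\<^sub>R w) < 0" using q \<rho> by simp
    ultimately show "x + s *\<^sub>R w \<in> slab t0 T \<inter> {q. \<phi> q < 0}" by simp
  qed
  then show ?thesis using \<rho>(1) by (intro exI[of _ "\<rho> / 2"]) auto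
qed

lemma convex_slab: "convex (slab t0 T :: ('b::euclidean_space \<times> real) set)"
proof -
  have "slab t0 T = (UNIV :: 'b set) \<times> {t0<..<T}" by (auto simp: slab_def)
  then show ?thesis by (simp add: convex_Times)
qed

lemma open_slab: "open (slab t0 T :: ('b::euclidean_space \<times> real) set)"
proof -
  have "slab t0 T = (UNIV :: 'b set) \<times> {t0<..<T}" by (auto simp: slab_def)
  then show ?thesis by (simp add: open_Times)
qed

text \<open>Near \<open>p\<close> the slab contains no zero of \<phi> but does contain a negative
  value, and its intersection with a ball is convex, hence connected. The intermediate value theorem
  excludes any nonnegative value.\<close>

lemma neg_near_boundary:
  fixes \<phi> :: "'b::euclidean_space \<times> real \<Rightarrow> real"
  assumes \<phi>: "continuous_on UNIV \<phi>"
    and p: "p \<in> closure (slab t0 T \<inter> {q. \<phi> q < 0})" "p \<notin> closure (slab t0 T \<inter> {q. \<phi> q = 0})"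
  shows "\<exists>r>0. \<forall>q\<in>ball p r. q \<in> slab t0 T \<longrightarrow> \<phi> q < 0"
proof -
  let ?Z = "slab t0 T \<inter> {q. \<phi> q = 0}"
  obtain r where "r > 0" "ball p r \<subseteq> - closure ?Z"
    using open_contains_ball[of "- closure ?Z"] p(2) by auto
  then have r: "r > 0" "ball p r \<inter> ?Z = {}"
    using closure_subset[of ?Z] by blast+
  obtain x where x: "x \<in> ball p r" "x \<in> slab t0 T" "\<phi> x < 0"
    using p(1) r(1) unfolding closure_approachable by (auto simp: dist_commute)
  let ?B = "ball p r \<inter> slab t0 T"
  have conn: "connected (\<phi> ` ?B)"
    by (intro connected_continuous_image convex_connected convex_Int convex_ball convex_slab)
      (meson \<phi> continuous_on_subset subset_UNIV)
  have "\<phi> q < 0" if q: "q \<in> ?B" for q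
  proof (rule ccontr)
    assume "\<not> \<phi> q < 0"
    then have "0 \<in> \<phi> ` ?B"
      using connectedD_interval[OF conn, of "\<phi> x" "\<phi> q" 0] x q by auto
    then show False using r(2) by auto
  qed
  then show ?thesis using r(1) by blast
qed

subsection \<open>Borel representatives\<close>

text \<open>Bridge from Lebesgue measure on \<open>Q\<close> to Borel functions on the whole space,
  which the translations and exchanges of integrals above work with: the extension by zero is
  changed on a null set.\<close>

lemma L2_on_borel_representative:
  fixes f :: "'a::euclidean_space \<Rightarrow> real"
  assumes Q: "Q \<in> sets borel" and f: "L2_on Q f"
  shows "\<exists>f0. f0 \<in> borel_measurable borel \<and> l2sq f0 < \<infinity> \<and> (AE x in lborel. indicator Q x * f x = f0 x)"
proof -
  have Q': "Q \<inter> space lebesgue \<in> sets lebesgue" using Q by simp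
  have m: "(\<lambda>x. indicator Q x * f x) \<in> borel_measurable lebesgue"
    using f borel_measurable_restrict_space_iff[OF Q', of f] by (simp add: L2_on_def)
  have i: "integrable lebesgue (\<lambda>x. indicator Q x * (f x)\<^sup>2)"
    using f integrable_restrict_space[OF Q', of "\<lambda>x. (f x)\<^sup>2"] by (simp add: L2_on_def)
  obtain f0 where f0: "f0 \<in> borel_measurable lborel" and eq: "AE x in lborel. indicator Q x * f x = f0 x"
    using completion_ex_borel_measurable_real[OF m] by blast
  have [measurable]: "f0 \<in> borel_measurable borel" using f0 by simp
  have "AE x in lborel. indicator Q x * (f x)\<^sup>2 = (f0 x)\<^sup>2"
    using eq by eventually_elim (auto simp: indicator_def split: if_splits)
  then have AE: "AE x in lebesgue. indicator Q x * (f x)\<^sup>2 = (f0 x)\<^sup>2"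
    by (rule AE_completion)
  have "(\<lambda>x. (f0 x)\<^sup>2) \<in> borel_measurable lebesgue"
    by (rule measurable_completion) simp
  then have "integrable lebesgue (\<lambda>x. (f0 x)\<^sup>2)"
    using i integrable_cong_AE[OF borel_measurable_integrable[OF i] _ AE] by simp
  then have "integrable lborel (\<lambda>x. (f0 x)\<^sup>2)"
    by (subst (asm) integrable_completion) auto
  then have "l2sq f0 < \<infinity>"
    by (simp add: l2sq_def integrable_iff_bounded)
  then show ?thesis using eq \<open>f0 \<in> borel_measurable borel\<close> by blast
qed

lemma integral_lebesgue_on_eq:
  fixes f f0 k :: "'a::euclidean_space \<Rightarrow> real"
  assumes Q: "Q \<in> sets borel" and f: "f \<in> borel_measurable (lebesgue_on Q)"
    and [measurable]: "f0 \<in> borel_measurable borel" "k \<in> borel_measurable borel"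
    and eq: "AE x in lborel. indicator Q x * f x = f0 x"
  shows "integral\<^sup>L (lebesgue_on Q) (\<lambda>x. f x * k x) = (\<integral>x. f0 x * k x \<partial>lborel)"
proof -
  have Q': "Q \<inter> space lebesgue \<in> sets lebesgue" using Q by simp
  have m [measurable]: "(\<lambda>x. indicator Q x * f x) \<in> borel_measurable lebesgue"
    using f borel_measurable_restrict_space_iff[OF Q', of f] by simp
  have [measurable]: "k \<in> borel_measurable lebesgue" by (rule measurable_completion) simp
  have "integral\<^sup>L (lebesgue_on Q) (\<lambda>x. f x * k x) = (\<integral>x. (indicator Q x * f x) * k x \<partial>lebesgue)"
    using integral_restrict_space[OF Q', of "\<lambda>x. f x * k x"] by (simp add: mult.assoc)
  also have "\<dots> = (\<integral>x. f0 x * k x \<partial>lebesgue)"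
  proof (rule integral_cong_AE)
    show "(\<lambda>x. f0 x * k x) \<in> borel_measurable lebesgue" by (rule measurable_completion) simp
    show "AE x in lebesgue. indicator Q x * f x * k x = f0 x * k x"
      by (rule AE_completion) (use eq in \<open>eventually_elim, simp\<close>)
  qed measurable
  also have "\<dots> = (\<integral>x. f0 x * k x \<partial>lborel)"
    by (rule integral_completion) simp
  finally show ?thesis .
qed

lemma L2_on_integral_le:
  fixes f F :: "'a::euclidean_space \<Rightarrow> real"
  assumes Q [measurable]: "Q \<in> sets borel" and f: "f \<in> borel_measurable (lebesgue_on Q)"
    and [measurable]: "F \<in> borel_measurable borel"
    and eq: "AE x in lborel. indicator Q x * f x = indicator Q x * F x"
    and le: "l2sq (\<lambda>x. indicator Q x * F x) \<le> ennreal e" and e: "e \<ge> 0"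
  shows "L2_on Q f" "integral\<^sup>L (lebesgue_on Q) (\<lambda>x. (f x)\<^sup>2) \<le> e"
proof -
  have Q': "Q \<inter> space lebesgue \<in> sets lebesgue" using Q by simp
  have m: "(\<lambda>x. indicator Q x * (f x)\<^sup>2) \<in> borel_measurable lebesgue"
    using borel_measurable_restrict_space_iff[OF Q', of "\<lambda>x. (f x)\<^sup>2"] f by simp
  have "AE x in lborel. indicator Q x * (f x)\<^sup>2 = (indicator Q x * F x)\<^sup>2"
    using eq by eventually_elim (auto simp: indicator_def)
  then have AE: "AE x in lebesgue. indicator Q x * (f x)\<^sup>2 = (indicator Q x * F x)\<^sup>2"
    by (rule AE_completion)
  have mF: "(\<lambda>x. (indicator Q x * F x)\<^sup>2) \<in> borel_measurable lebesgue"
    by (rule measurable_completion) simp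
  have F: "integrable lborel (\<lambda>x. (indicator Q x * F x)\<^sup>2)"
    using le by (intro integrableI_bounded) (auto simp: l2sq_def intro: le_less_trans)
  then have "integrable lebesgue (\<lambda>x. (indicator Q x * F x)\<^sup>2)"
    by (subst integrable_completion) auto
  then have "integrable lebesgue (\<lambda>x. indicator Q x * (f x)\<^sup>2)"
    using AE by (subst integrable_cong_AE[OF m mF]) auto
  then show "L2_on Q f"
    using f integrable_restrict_space[OF Q', of "\<lambda>x. (f x)\<^sup>2"] by (simp add: L2_on_def)
  have "integral\<^sup>L (lebesgue_on Q) (\<lambda>x. (f x)\<^sup>2) = (\<integral>x. indicator Q x * (f x)\<^sup>2 \<partial>lebesgue)"
    using integral_restrict_space[OF Q', of "\<lambda>x. (f x)\<^sup>2"] by simp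
  also have "\<dots> = (\<integral>x. (indicator Q x * F x)\<^sup>2 \<partial>lebesgue)"
    by (rule integral_cong_AE[OF m mF AE])
  also have "\<dots> = (\<integral>x. (indicator Q x * F x)\<^sup>2 \<partial>lborel)"
    by (rule integral_completion) simp
  also have "ennreal \<dots> = l2sq (\<lambda>x. indicator Q x * F x)"
    unfolding l2sq_def by (rule nn_integral_eq_integral[symmetric, OF F]) simp
  then have "ennreal (\<integral>x. (indicator Q x * F x)\<^sup>2 \<partial>lborel) \<le> ennreal e"
    using le by simp
  then have "(\<integral>x. (indicator Q x * F x)\<^sup>2 \<partial>lborel) \<le> e"
    by (subst (asm) ennreal_le_iff[OF e])
  finally show "integral\<^sup>L (lebesgue_on Q) (\<lambda>x. (f x)\<^sup>2) \<le> e" .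
qed

section \<open>Application to the evolving domain\<close>

lemma Qdom_eq: "Qdom \<phi> t0 T = slab t0 T \<inter> {q. \<phi> q < 0}"
  and GammaQ_eq: "GammaQ \<phi> t0 T = slab t0 T \<inter> {q. \<phi> q = 0}"
  by (auto simp: Qdom_def GammaQ_def slab_def)

lemma xdir_Basis: "xdir i \<in> Basis"
  by (auto simp: xdir_def Basis_prod_def Basis_vec_def)

lemma inj_xdir: "inj xdir"
  by (auto simp: inj_def xdir_def axis_eq_axis)

text \<open>A point in the closure of the domain but not of the lateral boundary is interior or lies
  on an end slice, and there a pure time shift suffices. Limit points of the lateral boundary on the
  end slices need a transversal direction too, which is why \<open>crit_unique\<close> is used on
  the closure.\<close>

lemma segment_at_Qdom:
  fixes \<phi> :: "(real^'n) \<times> real \<Rightarrow> real"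
  assumes smooth: "smooth_fun \<phi>"
    and crit_unique: "\<forall>p \<in> closure (GammaQ \<phi> t0 T). (\<forall>i. dir_deriv \<phi> (xdir i) p = 0) \<longrightarrow> p = (0, 0)"
    and dt: "dir_deriv \<phi> (0, 1) (0, 0) \<noteq> 0"
    and time: "if dir_deriv \<phi> (0, 1) (0, 0) < 0 then T \<noteq> 0 else t0 \<noteq> 0" and "t0 < T"
  shows "\<exists>r>0. segment_at (Qdom \<phi> t0 T) p r"
proof (cases "p \<in> closure (Qdom \<phi> t0 T)")
  case False
  then obtain r where r: "r > 0" "ball p r \<subseteq> - closure (Qdom \<phi> t0 T)"
    using open_contains_ball[of "- closure (Qdom \<phi> t0 T)"] by auto
  then have "Qdom \<phi> t0 T \<inter> ball p r = {}" using closure_subset by blast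
  then have "segment_at (Qdom \<phi> t0 T) p r"
    unfolding segment_at_def by (intro allI impI, rule_tac x = 0 in exI, rule_tac x = "\<eta> / 2" in exI) auto
  then show ?thesis using r(1) by blast
next
  case True
  have "closed {q :: (real^'n) \<times> real. t0 \<le> snd q \<and> snd q \<le> T}"
    by (intro closed_Collect_conj closed_Collect_le continuous_intros)
  then have "closure (Qdom \<phi> t0 T) \<subseteq> {q. t0 \<le> snd q \<and> snd q \<le> T}"
    by (intro closure_minimal) (auto simp: Qdom_def)
  then have p: "t0 \<le> snd p" "snd p \<le> T" using True by auto
  show ?thesis
  proof (cases "p \<in> closure (GammaQ \<phi> t0 T)")
    case False
    then obtain r where "r > 0" "\<And>q. q \<in> ball p r \<Longrightarrow> q \<in> slab t0 T \<Longrightarrow> \<phi> q < 0"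
      using neg_near_boundary[OF smooth_continuous_on[OF smooth]] True
      unfolding Qdom_eq GammaQ_eq by blast
    then show ?thesis
      unfolding Qdom_eq by (intro segment_at_flat p \<open>t0 < T\<close>)
  next
    case Gamma: True
    have lin: "linear (frechet_derivative \<phi> (at p))"
      by (rule has_derivative_linear[OF smooth_has_derivative[OF smooth]])
    have "\<exists>y. (snd p = T \<longrightarrow> snd y < 0) \<and> (snd p = t0 \<longrightarrow> snd y > 0) \<and> frechet_derivative \<phi> (at p) y < 0"
    proof (cases "p = (0, 0)")
      case True
      \<comment> \<open>The time direction in which \<phi> decreases. By \<open>time\<close> the
        critical point does not sit on the slice through which this direction would exit.\<close>
      define \<sigma> :: real where "\<sigma> = (if dir_deriv \<phi> (0, 1) (0, 0) < 0 then 1 else -1)"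
      have "frechet_derivative \<phi> (at p) (\<sigma> *\<^sub>R (0, 1)) = \<sigma> * dir_deriv \<phi> (0, 1) (0, 0)"
        unfolding linear_cmul[OF lin] by (simp add: dir_deriv_def True)
      also have "\<dots> < 0" using dt by (auto simp: \<sigma>_def)
      finally show ?thesis
        using time True by (intro exI[of _ "\<sigma> *\<^sub>R (0, 1)"]) (auto simp: \<sigma>_def split: if_splits)
    next
      case False
      then obtain i where i: "dir_deriv \<phi> (xdir i) p \<noteq> 0" using crit_unique Gamma by blast
      define \<tau> :: real where "\<tau> = (if snd p = T then -1 else 1)"
      let ?a = "dir_deriv \<phi> (xdir i) p" and ?b = "\<tau> * dir_deriv \<phi> (0, 1) p"
      \<comment> \<open>The spatial part contributes -(|b| + 1) to the derivative and the tilt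
        contributes \<open>?b\<close>, so the total is at most -1 whichever sign \<tau> has.\<close>
      let ?y = "(- (\<bar>?b\<bar> + 1) / ?a) *\<^sub>R xdir i + \<tau> *\<^sub>R (0, 1)"
      have "frechet_derivative \<phi> (at p) ?y = (- (\<bar>?b\<bar> + 1) / ?a) * ?a + ?b"
        unfolding linear_add[OF lin] linear_cmul[OF lin] by (simp add: dir_deriv_def)
      also have "\<dots> < 0" using i by simp
      finally show ?thesis
        using \<open>t0 < T\<close> by (intro exI[of _ ?y]) (auto simp: \<tau>_def xdir_def)
    qed
    then obtain y where "snd p = T \<Longrightarrow> snd y < 0" "snd p = t0 \<Longrightarrow> snd y > 0"
        "frechet_derivative \<phi> (at p) y < 0" by blast
    then show ?thesis
      unfolding Qdom_eq by (intro segment_at_transversal[OF smooth p])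
  qed
qed

theorem theorem3p1:
  fixes \<phi> :: "(real^'n) \<times> real \<Rightarrow> real" and t0 T :: real
  assumes dim: "CARD('n) = 2 \<or> CARD('n) = 3"
    and smooth: "smooth_fun \<phi>"
    and crit_in: "(0, 0) \<in> closure (GammaQ \<phi> t0 T)"
    and crit_grad: "\<forall>i. dir_deriv \<phi> (xdir i) (0, 0) = 0"
    and crit_unique: "\<forall>p \<in> closure (GammaQ \<phi> t0 T). (\<forall>i. dir_deriv \<phi> (xdir i) p = 0) \<longrightarrow> p = (0, 0)"
    and hess: "det (hess_x \<phi> (0, 0)) \<noteq> 0"
    and dt: "dir_deriv \<phi> (0, 1) (0, 0) \<noteq> 0"
    and bdd: "\<forall>t\<in>{t0..T}. bounded {x. \<phi> (x, t) < 0}"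
    and time: "if all_eig_pos (hess_x \<phi> (0, 0))
               then (if dir_deriv \<phi> (0, 1) (0, 0) < 0 then t0 = 0 \<and> T = 1 else t0 = -1 \<and> T = 0)
               else t0 = -1 \<and> T = 1"
  shows "\<forall>u g. L2_on (Qdom \<phi> t0 T) u
            \<and> (\<forall>i. L2_on (Qdom \<phi> t0 T) (g i) \<and> weak_deriv_on (Qdom \<phi> t0 T) (xdir i) u (g i))
          \<longrightarrow> (\<forall>\<epsilon>>0. \<exists>v. smooth_fun v
                  \<and> L2_on (Qdom \<phi> t0 T) (\<lambda>p. u p - v p)
                  \<and> (\<forall>i. L2_on (Qdom \<phi> t0 T) (\<lambda>p. g i p - dir_deriv v (xdir i) p))
                  \<and> H_dist (Qdom \<phi> t0 T) u g v < \<epsilon>)"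
proof (intro allI impI)
  fix u :: "(real^'n) \<times> real \<Rightarrow> real" and g :: "'n \<Rightarrow> (real^'n) \<times> real \<Rightarrow> real" and \<epsilon> :: real
  assume "L2_on (Qdom \<phi> t0 T) u
            \<and> (\<forall>i. L2_on (Qdom \<phi> t0 T) (g i) \<and> weak_deriv_on (Qdom \<phi> t0 T) (xdir i) u (g i))"
  then have u: "L2_on (Qdom \<phi> t0 T) u" and g: "\<And>i. L2_on (Qdom \<phi> t0 T) (g i)"
    and weak: "\<And>i. weak_deriv_on (Qdom \<phi> t0 T) (xdir i) u (g i)" by auto
  assume \<epsilon>: "\<epsilon> > 0"
  define Q where "Q = Qdom \<phi> t0 T"
  have "open Q"
    unfolding Q_def Qdom_eq
    by (intro open_Int open_slab open_Collect_less smooth_continuous_on smooth continuous_on_const)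
  then have Qb: "Q \<in> sets borel" by simp
  have um: "u \<in> borel_measurable (lebesgue_on Q)" and gm: "\<And>i. g i \<in> borel_measurable (lebesgue_on Q)"
    using u g by (auto simp: L2_on_def Q_def)
  obtain u0 where u0 [measurable]: "u0 \<in> borel_measurable borel" and u0_L2: "l2sq u0 < \<infinity>"
    and u0_eq: "AE x in lborel. indicator Q x * u x = u0 x"
    using L2_on_borel_representative[OF Qb u[folded Q_def]] by blast
  have "\<forall>i. \<exists>f0. f0 \<in> borel_measurable borel \<and> l2sq f0 < \<infinity> \<and> (AE x in lborel. indicator Q x * g i x = f0 x)"
    using L2_on_borel_representative[OF Qb g[folded Q_def]] by blast
  from choice[OF this] obtain g0 where g0: "\<And>i. g0 i \<in> borel_measurable borel" "\<And>i. l2sq (g0 i) < \<infinity>"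
    and g0_eq: "\<And>i. AE x in lborel. indicator Q x * g i x = g0 i x"
    by blast
  \<comment> \<open>The locale indexes derivatives by basis vectors, the theorem by coordinates;
    \<open>inv xdir\<close> translates between them on \<open>range xdir\<close>.\<close>
  interpret partial_sobolev Q "range xdir" u0 "\<lambda>b. g0 (inv xdir b)"
  proof
    fix \<psi> :: "(real^'n) \<times> real \<Rightarrow> real" and b :: "(real^'n) \<times> real"
    assume \<psi>: "test_fun Q \<psi>" and "b \<in> range xdir"
    then obtain i where b: "b = xdir i" by blast
    have s: "smooth_fun \<psi>" using \<psi> by (simp add: test_fun_def)
    have [measurable]: "\<psi> \<in> borel_measurable borel" "dir_deriv \<psi> b \<in> borel_measurable borel"
      using s by (auto simp: b intro!: borel_smooth smooth_dir_deriv xdir_Basis)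
    have "integral\<^sup>L (lebesgue_on Q) (\<lambda>p. u p * dir_deriv \<psi> b p)
        = - integral\<^sup>L (lebesgue_on Q) (\<lambda>p. g i p * \<psi> p)"
      using weak[of i] \<psi> unfolding weak_deriv_on_def Q_def b by blast
    moreover have "inv xdir b = i" by (simp add: b inj_xdir)
    ultimately show "(\<integral>w. u0 w * dir_deriv \<psi> b w \<partial>lborel) = - (\<integral>w. g0 (inv xdir b) w * \<psi> w \<partial>lborel)"
      by (simp add: integral_lebesgue_on_eq[OF Qb um u0 _ u0_eq]
          integral_lebesgue_on_eq[OF Qb gm g0(1) _ g0_eq])
  qed (use Qb u0 u0_L2 g0 xdir_Basis in auto)
  \<comment> \<open>In every branch of \<open>time\<close>, a negative time derivative comes with
    \<open>T = 1\<close> and a positive one with \<open>t0 = -1\<close>.\<close>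
  have T: "t0 < T" "if dir_deriv \<phi> (0, 1) (0, 0) < 0 then T \<noteq> 0 else t0 \<noteq> 0"
    using time by (auto split: if_splits)
  \<comment> \<open>One term for the function and one for each spatial derivative. The factor 2 in
    \<open>e\<close> makes the final inequality strict.\<close>
  define N where "N = real (CARD('n)) + 1"
  define e where "e = \<epsilon>\<^sup>2 / (2 * N)"
  have N: "N > 0" by (simp add: N_def add_nonneg_pos)
  then have e: "e > 0" using \<epsilon> by (simp add: e_def)
  from smooth_dense[OF segment_at_Qdom[OF smooth crit_unique dt T(2,1), folded Q_def] e]
  obtain v where v: "smooth_fun v" "l2sq (\<lambda>x. indicator Q x * (u0 x - v x)) \<le> ennreal e"
    "\<And>b. b \<in> range xdir \<Longrightarrow>
      l2sq (\<lambda>x. indicator Q x * (g0 (inv xdir b) x - dir_deriv v b x)) \<le> ennreal e"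
    by blast
  have close: "L2_on Q (\<lambda>x. f x - w x) \<and> integral\<^sup>L (lebesgue_on Q) (\<lambda>x. (f x - w x)\<^sup>2) \<le> e"
    if f: "f \<in> borel_measurable (lebesgue_on Q)" and f0 [measurable]: "f0 \<in> borel_measurable borel"
      and eq: "AE x in lborel. indicator Q x * f x = f0 x" and w: "smooth_fun w"
      and le: "l2sq (\<lambda>x. indicator Q x * (f0 x - w x)) \<le> ennreal e" for f f0 w
  proof -
    have [measurable]: "w \<in> borel_measurable borel" by (rule borel_smooth[OF w])
    have "w \<in> borel_measurable lebesgue" by (rule measurable_completion) simp
    then have "w \<in> borel_measurable (lebesgue_on Q)" by (rule measurable_restrict_space1)
    then have m: "(\<lambda>x. f x - w x) \<in> borel_measurable (lebesgue_on Q)"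
      by (intro borel_measurable_diff f)
    have eq': "AE x in lborel. indicator Q x * (f x - w x) = indicator Q x * (f0 x - w x)"
      using eq by eventually_elim (auto simp: indicator_def)
    show ?thesis
      using L2_on_integral_le[OF Qb m _ eq' le] e by simp
  qed
  have cu: "L2_on Q (\<lambda>p. u p - v p)" "integral\<^sup>L (lebesgue_on Q) (\<lambda>p. (u p - v p)\<^sup>2) \<le> e"
    using close[OF um u0 u0_eq v(1,2)] by auto
  have cg: "L2_on Q (\<lambda>p. g i p - dir_deriv v (xdir i) p)"
    "integral\<^sup>L (lebesgue_on Q) (\<lambda>p. (g i p - dir_deriv v (xdir i) p)\<^sup>2) \<le> e" for i
    using close[OF gm g0(1) g0_eq smooth_dir_deriv[OF v(1) xdir_Basis], of i i] v(3)[of "xdir i"]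
    by (auto simp: inj_xdir)
  have "integral\<^sup>L (lebesgue_on Q) (\<lambda>p. (u p - v p)\<^sup>2)
      + (\<Sum>i\<in>UNIV. integral\<^sup>L (lebesgue_on Q) (\<lambda>p. (g i p - dir_deriv v (xdir i) p)\<^sup>2))
      \<le> e + (\<Sum>i\<in>(UNIV::'n set). e)"
    by (intro add_mono sum_mono cu cg)
  also have "\<dots> = N * e" by (simp add: N_def algebra_simps)
  also have "\<dots> = \<epsilon>\<^sup>2 / 2" using N by (simp add: e_def)
  also have "\<dots> < \<epsilon>\<^sup>2" using \<epsilon> by simp
  finally have "H_dist Q u g v < \<epsilon>"
    unfolding H_dist_def using \<epsilon> by (intro real_less_lsqrt) auto
  then show "\<exists>v. smooth_fun v \<and> L2_on (Qdom \<phi> t0 T) (\<lambda>p. u p - v p)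
      \<and> (\<forall>i. L2_on (Qdom \<phi> t0 T) (\<lambda>p. g i p - dir_deriv v (xdir i) p))
      \<and> H_dist (Qdom \<phi> t0 T) u g v < \<epsilon>"
    using v(1) cu(1) cg(1) unfolding Q_def by blast
qed

end
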